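(* Let $M=(m(i,j))_{i,j\in[n]}$ be an even Coxeter matrix over $[n]=\{1,\dots,n\}$, and let $A_M=F/R$ be the associated even Artin group, where $F$ is the free group on $\{a_i\mid i\in[n]\}$ and $R$ is the normal closure in $F$ of the elements $(a_ia_j)^{n(i,j)}(a_ja_i)^{-n(i,j)}$ for $(i,j)\in\mathcal{B}$. Then the second integral homology group $H_2(A_M)\cong R/[F,R]$ is a free abelian group whose basis is given by $$\{[a_i,a_j]^{n(i,j)}\bmod [F,R]\mid (i,j)\in\mathcal{B}\}.$$
   Context: Let $n\ge 1$ and $[n]=\{1,\dots,n\}$. A Coxeter matrix over $[n]$ is a symmetric $n\times n$ matrix $M=(m(i,j))$ with $m(i,i)=1$ for all $i$ and $m(i,j)=m(j,i)\in\{2,3,4,\dots\}\cup\{\infty\}$ for $i\ne j$. It is even if every $m(i,j)$ with $i\neq j$ is an even positive integer or $\infty$. For $M$ even and $i\neq j$, put $n(i,j)=m(i,j)/2$ if $m(i,j)<\infty$ and $n(i,j)=\infty$ otherwise, and set $\mathcal{B}=\{(i,j)\mid 1\le i<j\le n,\ n(i,j)<\infty\}$. The even Artin group $A_M$ is the group generated by $a_i$ ($i\in[n]$) with defining relations $(a_ia_j)^{n(i,j)}=(a_ja_i)^{n(i,j)}$ for all $i\neq j$ with $n(i,j)<\infty$. Commutators are $[g,h]=ghg^{-1}h^{-1}$, and $[F,R]$ is the subgroup generated by all $[f,r]$ with $f\in F$, $r\in R$. For a normal subgroup $N$, $g\bmod N$ denotes the coset $gN$. Homology is with coefficients in $\mathbb{Z}$.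 Hopf's formula states $H_2(F/R)\cong (R\cap[F,F])/[F,R]$; here $R\subset[F,F]$, so $H_2(A_M)\cong R/[F,R]$.
   Formalization: The literal power [a_i,a_j]^{n(i,j)} need not lie in R when n(i,j)≥2, so the basis is taken to be the classes of the relators (a_ia_j)^{n(i,j)}(a_ja_i)^{-n(i,j)}, which are congruent to those powers modulo [F,[F,F]], with R∩[F,[F,F]]=[F,R]. *)

theory Defs
  imports "HOL-Algebra.Algebra" "HOL-Library.Extended_Nat"
begin

section \<open>Free groups\<close>

text \<open>A letter \<open>(x, True)\<close> stands for the generator \<open>x\<close> and \<open>(x, False)\<close> for its inverse.
  The elements of the free group are the reduced words.\<close>

type_synonym 'a letter = "'a \<times> bool"

definition inv_letter :: "'a letter \<Rightarrow> 'a letter" where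
  "inv_letter l = (fst l, \<not> snd l)"

definition reduced :: "'a letter list \<Rightarrow> bool" where
  "reduced w \<longleftrightarrow> successively (\<lambda>k l. l \<noteq> inv_letter k) w"

fun push :: "'a letter \<Rightarrow> 'a letter list \<Rightarrow> 'a letter list" where
  "push l [] = [l]"
| "push l (k # w) = (if k = inv_letter l then w else l # k # w)"

definition free_group :: "'a set \<Rightarrow> 'a letter list monoid" where
  "free_group S =
     \<lparr>carrier = {w. set w \<subseteq> S \<times> UNIV \<and> reduced w}, monoid.mult = foldr push, one = []\<rparr>"

definition free_gen :: "'a \<Rightarrow> 'a letter list" where
  "free_gen x = [(x, True)]"

lemma inv_letter_inv_letter [simp]: "inv_letter (inv_letter l) = l"
  by (simp add: inv_letter_def)

lemma inv_letter_neq [simp]: "inv_letter l \<noteq> l" "l \<noteq> inv_letter l"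
  by (auto simp: inv_letter_def prod_eq_iff)

lemma inv_letter_in_iff [simp]: "inv_letter l \<in> S \<times> UNIV \<longleftrightarrow> l \<in> S \<times> UNIV"
  by (auto simp: inv_letter_def mem_Times_iff)

lemma reduced_Nil [simp]: "reduced []"
  by (simp add: reduced_def)

lemma reduced_Cons: "reduced (l # w) \<longleftrightarrow> reduced w \<and> (w = [] \<or> hd w \<noteq> inv_letter l)"
  by (cases w) (auto simp: reduced_def)

lemma reduced_push: "reduced w \<Longrightarrow> reduced (push l w)"
  by (cases w) (auto simp: reduced_Cons)

lemma reduced_foldr_push: "reduced w \<Longrightarrow> reduced (foldr push u w)"
  by (induction u) (auto intro: reduced_push)

lemma push_reduced: "reduced (l # w) \<Longrightarrow> push l w = l # w"
  by (cases w) (auto simp: reduced_Cons)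

lemma push_push_inv: "reduced w \<Longrightarrow> push l (push (inv_letter l) w) = w"
  by (cases w) (auto simp: reduced_Cons push_reduced)

lemma set_push: "set (push l w) \<subseteq> insert l (set w)"
  by (cases w) auto

lemma set_foldr_push: "set (foldr push u w) \<subseteq> set u \<union> set w"
proof (induction u)
  case (Cons l u)
  then show ?case using set_push[of l "foldr push u w"] by auto
qed simp

lemma foldr_push_push:
  assumes "reduced w"
  shows "foldr push (push l u) w = push l (foldr push u w)"
proof (cases u)
  case (Cons k v)
  show ?thesis
  proof (cases "k = inv_letter l")
    case True
    then show ?thesis
      using Cons push_push_inv[OF reduced_foldr_push[OF assms], of l v] by simp
  qed (simp add: Cons)
qed simp

lemma foldr_push_assoc:
  "reduced w \<Longrightarrow> foldr push (foldr push u v) w = foldr push u (foldr push v w)"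
  by (induction u) (auto simp: foldr_push_push)

lemma foldr_push_Nil: "reduced w \<Longrightarrow> foldr push w [] = w"
  by (induction w) (auto simp: reduced_Cons push_reduced)

lemma foldr_push_inverse:
  "reduced w \<Longrightarrow> foldr push (rev (map inv_letter u)) (foldr push u w) = w"
proof (induction u arbitrary: w)
  case (Cons l u)
  then show ?case
    using push_push_inv[OF reduced_foldr_push, of w "inv_letter l" u] by simp
qed simp

lemma group_free_group: "group (free_group S)"
proof (rule groupI)
  fix w assume w: "w \<in> carrier (free_group S)"
  let ?v = "foldr push (rev (map inv_letter w)) []"
  have "set ?v \<subseteq> S \<times> UNIV"
  proof -
    have "set (rev (map inv_letter w)) \<subseteq> S \<times> UNIV"
      using w by (auto simp: free_group_def inv_letter_def)
    then show ?thesis using set_foldr_push[of "rev (map inv_letter w)" "[]"] by auto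
  qed
  then have "?v \<in> carrier (free_group S)"
    by (simp add: free_group_def reduced_foldr_push)
  moreover have "?v \<otimes>\<^bsub>free_group S\<^esub> w = \<one>\<^bsub>free_group S\<^esub>"
    using w foldr_push_inverse[of "[]" w]
    by (simp add: free_group_def foldr_push_assoc foldr_push_Nil)
  ultimately show "\<exists>v\<in>carrier (free_group S). v \<otimes>\<^bsub>free_group S\<^esub> w = \<one>\<^bsub>free_group S\<^esub>"
    by blast
next
  fix u v assume "u \<in> carrier (free_group S)" "v \<in> carrier (free_group S)"
  then show "u \<otimes>\<^bsub>free_group S\<^esub> v \<in> carrier (free_group S)"
    using set_foldr_push[of u v] by (auto simp: free_group_def reduced_foldr_push)
qed (auto simp: free_group_def foldr_push_assoc)

section \<open>Commutators and normal closures\<close>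

definition commutator :: "('a, 'b) monoid_scheme \<Rightarrow> 'a \<Rightarrow> 'a \<Rightarrow> 'a" where
  "commutator G g h = g \<otimes>\<^bsub>G\<^esub> h \<otimes>\<^bsub>G\<^esub> inv\<^bsub>G\<^esub> g \<otimes>\<^bsub>G\<^esub> inv\<^bsub>G\<^esub> h"

definition commutator_subgroup :: "('a, 'b) monoid_scheme \<Rightarrow> 'a set \<Rightarrow> 'a set \<Rightarrow> 'a set" where
  "commutator_subgroup G H K = generate G {commutator G h k | h k. h \<in> H \<and> k \<in> K}"

definition normal_closure :: "('a, 'b) monoid_scheme \<Rightarrow> 'a set \<Rightarrow> 'a set" where
  "normal_closure G S =
     generate G {g \<otimes>\<^bsub>G\<^esub> s \<otimes>\<^bsub>G\<^esub> inv\<^bsub>G\<^esub> g | g s. g \<in> carrier G \<and> s \<in> S}"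

section \<open>Integral group homology\<close>

text \<open>The homology of \<open>G\<close> with trivial coefficients \<open>\<int>\<close>, computed from the unnormalised bar
  complex: the group of \<open>p\<close>-chains is free abelian on the lists \<open>[g\<^sub>1|\<dots>|g\<^sub>p]\<close>, and
  \<open>\<partial>[g\<^sub>1|\<dots>|g\<^sub>p] = [g\<^sub>2|\<dots>|g\<^sub>p] + (\<Sum>0<i<p. (-1)\<^sup>i [g\<^sub>1|\<dots>|g\<^sub>i g\<^sub>i\<^sub>+\<^sub>1|\<dots>|g\<^sub>p]) + (-1)\<^sup>p [g\<^sub>1|\<dots>|g\<^sub>p\<^sub>-\<^sub>1]\<close>.\<close>

definition bar_chain_group ::
    "nat \<Rightarrow> ('a, 'b) monoid_scheme \<Rightarrow> ('a list \<Rightarrow>\<^sub>0 int) monoid" where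
  "bar_chain_group p G = free_Abelian_group {gs. length gs = p \<and> set gs \<subseteq> carrier G}"

definition bar_face :: "('a, 'b) monoid_scheme \<Rightarrow> nat \<Rightarrow> 'a list \<Rightarrow> 'a list" where
  "bar_face G i gs =
     (if i = 0 then tl gs
      else if i = length gs then butlast gs
      else take (i - 1) gs @ [gs ! (i - 1) \<otimes>\<^bsub>G\<^esub> gs ! i] @ drop (i + 1) gs)"

definition bar_boundary ::
    "nat \<Rightarrow> ('a, 'b) monoid_scheme \<Rightarrow> ('a list \<Rightarrow>\<^sub>0 int) \<Rightarrow> ('a list \<Rightarrow>\<^sub>0 int)" where
  "bar_boundary p G c =
     (if p = 0 then 0
      else frag_extend (\<lambda>gs. \<Sum>i\<le>p. frag_cmul ((-1) ^ i) (frag_of (bar_face G i gs))) c)"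

definition bar_cycles :: "nat \<Rightarrow> ('a, 'b) monoid_scheme \<Rightarrow> ('a list \<Rightarrow>\<^sub>0 int) set" where
  "bar_cycles p G = {c \<in> carrier (bar_chain_group p G). bar_boundary p G c = 0}"

definition bar_boundaries :: "nat \<Rightarrow> ('a, 'b) monoid_scheme \<Rightarrow> ('a list \<Rightarrow>\<^sub>0 int) set" where
  "bar_boundaries p G = bar_boundary (Suc p) G ` carrier (bar_chain_group (Suc p) G)"

definition group_homology ::
    "nat \<Rightarrow> ('a, 'b) monoid_scheme \<Rightarrow> ('a list \<Rightarrow>\<^sub>0 int) set monoid" where
  "group_homology p G = (bar_chain_group p G)\<lparr>carrier := bar_cycles p G\<rparr> Mod bar_boundaries p G"

section \<open>Bases of abelian groups\<close>

text \<open>\<open>G\<close> is free abelian with basis the family \<open>(x i)\<close>, \<open>i \<in> I\<close>.  As a family, a basis has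
  no repetitions.\<close>

definition is_free_abelian_basis ::
    "('a, 'b) monoid_scheme \<Rightarrow> 'i set \<Rightarrow> ('i \<Rightarrow> 'a) \<Rightarrow> bool" where
  "is_free_abelian_basis G I x \<longleftrightarrow>
     comm_group G \<and> (\<exists>h \<in> iso (free_Abelian_group I) G. \<forall>i\<in>I. h (frag_of i) = x i)"

section \<open>Even Artin groups\<close>

definition coxeter_matrix :: "nat \<Rightarrow> (nat \<Rightarrow> nat \<Rightarrow> enat) \<Rightarrow> bool" where
  "coxeter_matrix n m \<longleftrightarrow>
     (\<forall>i\<in>{1..n}. m i i = 1) \<and>
     (\<forall>i\<in>{1..n}. \<forall>j\<in>{1..n}. i \<noteq> j \<longrightarrow> m i j = m j i \<and> 2 \<le> m i j)"

definition even_coxeter_matrix :: "nat \<Rightarrow> (nat \<Rightarrow> nat \<Rightarrow> enat) \<Rightarrow> bool" where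
  "even_coxeter_matrix n m \<longleftrightarrow> coxeter_matrix n m \<and>
     (\<forall>i\<in>{1..n}. \<forall>j\<in>{1..n}. i \<noteq> j \<longrightarrow> m i j = \<infinity> \<or> (\<exists>k. even k \<and> m i j = enat k))"

definition half_exponent :: "(nat \<Rightarrow> nat \<Rightarrow> enat) \<Rightarrow> nat \<Rightarrow> nat \<Rightarrow> enat" where
  "half_exponent m i j = (case m i j of enat k \<Rightarrow> enat (k div 2) | \<infinity> \<Rightarrow> \<infinity>)"

definition finite_pairs :: "nat \<Rightarrow> (nat \<Rightarrow> nat \<Rightarrow> enat) \<Rightarrow> (nat \<times> nat) set" where
  "finite_pairs n m = {(i, j). 1 \<le> i \<and> i < j \<and> j \<le> n \<and> half_exponent m i j < \<infinity>}"

abbreviation artin_free :: "nat \<Rightarrow> nat letter list monoid" where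
  "artin_free n \<equiv> free_group {1..n}"

text \<open>The relator \<open>(a\<^sub>i a\<^sub>j)\<^sup>k (a\<^sub>j a\<^sub>i)\<^sup>-\<^sup>k\<close> with \<open>k = n(i,j)\<close>.  It is a product of \<open>k\<close>
  conjugates of \<open>[a\<^sub>i,a\<^sub>j]\<close>, hence congruent to \<open>[a\<^sub>i,a\<^sub>j]\<^sup>k\<close> modulo \<open>[F,[F,F]]\<close>, and the class
  written \<open>[a\<^sub>i,a\<^sub>j]\<^sup>k mod [F,R]\<close> is the class of this relator.  The literal power
  \<open>[a\<^sub>i,a\<^sub>j]\<^sup>k\<close> need not lie in \<open>R\<close> for \<open>k \<ge> 2\<close>: for \<open>n = 2\<close> and \<open>k = 2\<close>, sending
  \<open>a\<^sub>1\<close> to a 3-cycle and \<open>a\<^sub>2\<close> to a transposition of \<open>S\<^sub>3\<close> kills the relator, but not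
  \<open>[a\<^sub>1,a\<^sub>2]\<^sup>2\<close>.\<close>

definition artin_relator :: "nat \<Rightarrow> (nat \<Rightarrow> nat \<Rightarrow> enat) \<Rightarrow> nat \<Rightarrow> nat \<Rightarrow> nat letter list" where
  "artin_relator n m i j =
     (let F = artin_free n; k = the_enat (half_exponent m i j)
      in (free_gen i \<otimes>\<^bsub>F\<^esub> free_gen j) [^]\<^bsub>F\<^esub> k \<otimes>\<^bsub>F\<^esub> inv\<^bsub>F\<^esub> ((free_gen j \<otimes>\<^bsub>F\<^esub> free_gen i) [^]\<^bsub>F\<^esub> k))"

definition artin_relations :: "nat \<Rightarrow> (nat \<Rightarrow> nat \<Rightarrow> enat) \<Rightarrow> nat letter list set" where
  "artin_relations n m =
     normal_closure (artin_free n) {artin_relator n m i j | i j. (i, j) \<in> finite_pairs n m}"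

definition artin_group :: "nat \<Rightarrow> (nat \<Rightarrow> nat \<Rightarrow> enat) \<Rightarrow> nat letter list set monoid" where
  "artin_group n m = artin_free n Mod artin_relations n m"

end

theory Submission
  imports Defs
begin

text \<open>A 2-cocycle on a free group \<open>F\<close> with values in an abelian group splits, since the central
  extension it defines does.  Both halves of the theorem come from this.  For the cocycle
  \<open>x\<^sub>i(u) x\<^sub>j(v)\<close> of exponent sums, a splitting is an integer-valued function on \<open>F\<close> that is
  additive on \<open>[F,F]\<close>, vanishes on \<open>[F,[F,F]]\<close> and sends \<open>[a\<^sub>k,a\<^sub>l]\<close> with \<open>k < l\<close> to 1 if
  \<open>(k,l) = (i,j)\<close> and to 0 otherwise.  As the relators are congruent to powers of the
  \<open>[a\<^sub>i,a\<^sub>j]\<close> modulo \<open>[F,[F,F]]\<close>, these functions separate them in \<open>R/[F,R]\<close>, which the relators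
  generate.  For Hopf's formula, a factor set of \<open>F \<rightarrow> F/R\<close> maps the 2-cycles of the bar complex to
  \<open>R/[F,R]\<close>.  The classes of the cells \<open>[g|h]\<close> modulo boundaries form a cocycle on \<open>F/R\<close>, and a
  splitting of its pullback to \<open>F\<close> gives the inverse on homology.\<close>


section \<open>Free groups and cocycles\<close>

text \<open>The obstacle is to find maps out of R/[F,R]. As R lies in [F,F], every hom from F to an
  abelian group is trivial on R and detects nothing there. A splitting of a cocycle is the next best
  thing: it fails to be additive exactly by the cocycle, so if the cocycle vanishes whenever one
  argument lies in R, the splitting restricts to a hom on R that kills [F,R], without being a hom on
  F. Both cocycles are arranged to vanish in this way. The functional of a pair (i,j) takes the
  value n(i,j), not 1, on its relator; linear independence over the integers only needs this value
  to be nonzero. The functionals vanish on all of [F,[F,F]] and not merely on [F,R], so the relators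
  stay independent modulo [F,[F,F]], which yields R \<inter> [F,[F,F]] = [F,R]. In the surjectivity
  half of Hopf's formula the obstacle turns into the tool: a splitting corrected to a hom on F must
  be trivial at r.\<close>

lemma free_gen_closed: "x \<in> S \<Longrightarrow> free_gen x \<in> carrier (free_group S)"
  by (auto simp: free_group_def free_gen_def reduced_def)

text \<open>A nonempty reduced word is the product of its first letter and the rest, since
  \<open>push\<close> cancels nothing there. Hence homs on the free group can be compared on
  generators.\<close>

lemma generate_free_gen: "generate (free_group S) (free_gen ` S) = carrier (free_group S)"
proof -
  interpret F: group "free_group S" by (rule group_free_group)
  have gens: "free_gen ` S \<subseteq> carrier (free_group S)"
    by (auto simp: free_gen_closed)
  have "w \<in> carrier (free_group S) \<Longrightarrow> w \<in> generate (free_group S) (free_gen ` S)" for w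
  proof (induction w)
    case Nil
    then show ?case
      using generate.one[of "free_group S" "free_gen ` S"] by (simp add: free_group_def)
  next
    case (Cons l w)
    obtain x b where l: "l = (x, b)" by fastforce
    have x: "x \<in> S" and w: "w \<in> carrier (free_group S)"
      using Cons.prems by (auto simp: free_group_def reduced_Cons l)
    have "[(x, False)] \<in> carrier (free_group S)" "[(x, False)] \<otimes>\<^bsub>free_group S\<^esub> free_gen x = \<one>\<^bsub>free_group S\<^esub>"
      using x by (auto simp: free_group_def reduced_def free_gen_def inv_letter_def)
    then have "inv\<^bsub>free_group S\<^esub> (free_gen x) = [(x, False)]"
      using F.inv_equality free_gen_closed[OF x] by blast
    then have "[l] \<in> generate (free_group S) (free_gen ` S)"
      using x generate.incl[of "free_gen x" "free_gen ` S" "free_group S"]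
        generate.inv[of "free_gen x" "free_gen ` S" "free_group S"]
      by (cases b) (auto simp: l free_gen_def)
    moreover have "l # w = [l] \<otimes>\<^bsub>free_group S\<^esub> w"
      using Cons.prems by (simp add: free_group_def push_reduced)
    ultimately show ?case
      using generate.eng Cons.IH[OF w] by metis
  qed
  then show ?thesis
    using F.generate_incl[OF gens] by blast
qed

lemma (in group) hom_eq_on_generate:
  assumes "group H" "f \<in> hom G H" "g \<in> hom G H" "S \<subseteq> carrier G"
    and eq: "\<And>x. x \<in> S \<Longrightarrow> f x = g x"
    and x: "x \<in> generate G S"
  shows "f x = g x"
proof -
  interpret f: group_hom G H f using assms by (simp add: group_hom_def group_hom_axioms_def group_axioms)
  interpret g: group_hom G H g using assms by (simp add: group_hom_def group_hom_axioms_def group_axioms)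
  show ?thesis
    using x
  proof (induction rule: generate.induct)
    case (inv h)
    then show ?case using eq assms(4) by (metis f.hom_inv g.hom_inv subsetD)
  next
    case (eng h1 h2)
    then show ?case using generate_in_carrier[OF assms(4)] by simp
  qed (simp_all add: eq)
qed

text \<open>Words are evaluated letter by letter. A cancellation made by \<open>push\<close> becomes
  a cancellation of mutually inverse values in \<open>H\<close>, so evaluation is multiplicative for
  the reduced product.\<close>

lemma free_group_universal:
  fixes f :: "'a \<Rightarrow> 'b"
  assumes "group H" and f: "\<And>x. x \<in> S \<Longrightarrow> f x \<in> carrier H"
  obtains h where "h \<in> hom (free_group S) H" "\<And>x. x \<in> S \<Longrightarrow> h (free_gen x) = f x"
proof -
  interpret H: group H by fact
  define val where "val l = (if snd l then f (fst l) else inv\<^bsub>H\<^esub> (f (fst l)))" for l :: "'a letter"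
  define h where "h w = foldr (\<lambda>l. (\<otimes>\<^bsub>H\<^esub>) (val l)) w \<one>\<^bsub>H\<^esub>" for w
  have val: "val l \<in> carrier H" if "l \<in> S \<times> UNIV" for l
    using that f by (auto simp: val_def)
  have val_inv: "val (inv_letter l) = inv\<^bsub>H\<^esub> (val l)" if "l \<in> S \<times> UNIV" for l
    using that f by (auto simp: val_def inv_letter_def)
  have h_simps: "h [] = \<one>\<^bsub>H\<^esub>" "h (l # w) = val l \<otimes>\<^bsub>H\<^esub> h w" for l w
    by (simp_all add: h_def)
  have h_closed: "h w \<in> carrier H" if "set w \<subseteq> S \<times> UNIV" for w
    using that val by (induction w) (auto simp: h_simps)
  have h_push: "h (push l w) = val l \<otimes>\<^bsub>H\<^esub> h w" if "l \<in> S \<times> UNIV" "set w \<subseteq> S \<times> UNIV" for l w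
  proof (cases w)
    case (Cons k v)
    have "val l \<otimes>\<^bsub>H\<^esub> (inv\<^bsub>H\<^esub> (val l) \<otimes>\<^bsub>H\<^esub> h v) = h v"
      using that val[of l] h_closed[of v] Cons by (simp add: H.m_assoc[symmetric])
    then show ?thesis
      using that Cons by (simp add: h_simps val_inv)
  qed (simp add: h_simps)
  have h_mult: "h (foldr push u w) = h u \<otimes>\<^bsub>H\<^esub> h w"
    if "set u \<subseteq> S \<times> UNIV" "set w \<subseteq> S \<times> UNIV" for u w
    using that(1)
  proof (induction u)
    case (Cons l u)
    have "set (foldr push u w) \<subseteq> S \<times> UNIV"
      using Cons.prems that(2) set_foldr_push[of u w] by auto
    then show ?case
      using Cons h_push[of l "foldr push u w"] that(2) val[of l] h_closed
      by (simp add: h_simps H.m_assoc)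
  qed (simp add: h_simps h_closed that)
  show thesis
  proof
    show "h \<in> hom (free_group S) H"
      by (auto simp: hom_def free_group_def h_closed h_mult)
    show "h (free_gen x) = f x" if "x \<in> S" for x
      using that f by (simp add: free_gen_def h_simps val_def)
  qed
qed

section \<open>Central extensions and the splitting of 2-cocycles\<close>

text \<open>Cocycles are not assumed normalised: the value at the identity pair may be nontrivial,
  and its inverse therefore appears in the unit.\<close>

definition central_extension ::
    "('a, 'b) monoid_scheme \<Rightarrow> ('g, 'c) monoid_scheme \<Rightarrow> ('g \<Rightarrow> 'g \<Rightarrow> 'a) \<Rightarrow> ('a \<times> 'g) monoid" where
  "central_extension Q G c =
     \<lparr>carrier = carrier Q \<times> carrier G,
      monoid.mult = (\<lambda>(q, u) (p, v). (q \<otimes>\<^bsub>Q\<^esub> p \<otimes>\<^bsub>Q\<^esub> c u v, u \<otimes>\<^bsub>G\<^esub> v)),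
      one = (inv\<^bsub>Q\<^esub> (c \<one>\<^bsub>G\<^esub> \<one>\<^bsub>G\<^esub>), \<one>\<^bsub>G\<^esub>)\<rparr>"

lemma group_central_extension:
  assumes "comm_group Q" "group G"
    and c: "\<And>u v. u \<in> carrier G \<Longrightarrow> v \<in> carrier G \<Longrightarrow> c u v \<in> carrier Q"
    and cocycle: "\<And>u v w. u \<in> carrier G \<Longrightarrow> v \<in> carrier G \<Longrightarrow> w \<in> carrier G \<Longrightarrow>
      c u v \<otimes>\<^bsub>Q\<^esub> c (u \<otimes>\<^bsub>G\<^esub> v) w = c v w \<otimes>\<^bsub>Q\<^esub> c u (v \<otimes>\<^bsub>G\<^esub> w)"
  shows "group (central_extension Q G c)"
proof -
  interpret Q: comm_group Q by fact
  interpret G: group G by fact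
  \<comment> \<open>The cocycle identity at the triple (1, 1, u) has c(1,u) once on the left and
    twice on the right; cancelling one copy gives the claim.\<close>
  have c_one: "c \<one>\<^bsub>G\<^esub> u = c \<one>\<^bsub>G\<^esub> \<one>\<^bsub>G\<^esub>" if "u \<in> carrier G" for u
    using cocycle[of "\<one>\<^bsub>G\<^esub>" "\<one>\<^bsub>G\<^esub>" u] that c by (simp add: Q.m_comm)
  have *: "q \<otimes>\<^bsub>Q\<^esub> p \<otimes>\<^bsub>Q\<^esub> c u v \<otimes>\<^bsub>Q\<^esub> r \<otimes>\<^bsub>Q\<^esub> c (u \<otimes>\<^bsub>G\<^esub> v) w =
      q \<otimes>\<^bsub>Q\<^esub> (p \<otimes>\<^bsub>Q\<^esub> r \<otimes>\<^bsub>Q\<^esub> c v w) \<otimes>\<^bsub>Q\<^esub> c u (v \<otimes>\<^bsub>G\<^esub> w)"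
    if "q \<in> carrier Q" "p \<in> carrier Q" "r \<in> carrier Q"
      "u \<in> carrier G" "v \<in> carrier G" "w \<in> carrier G" for q p r u v w
  proof -
    have "q \<otimes>\<^bsub>Q\<^esub> p \<otimes>\<^bsub>Q\<^esub> c u v \<otimes>\<^bsub>Q\<^esub> r \<otimes>\<^bsub>Q\<^esub> c (u \<otimes>\<^bsub>G\<^esub> v) w =
        q \<otimes>\<^bsub>Q\<^esub> p \<otimes>\<^bsub>Q\<^esub> r \<otimes>\<^bsub>Q\<^esub> (c u v \<otimes>\<^bsub>Q\<^esub> c (u \<otimes>\<^bsub>G\<^esub> v) w)"
      using that c by (simp add: Q.m_ac)
    then show ?thesis
      using that c by (simp add: cocycle Q.m_assoc)
  qed
  show ?thesis
  proof (rule groupI)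
    fix x assume "x \<in> carrier (central_extension Q G c)"
    then obtain q u where x: "x = (q, u)" "q \<in> carrier Q" "u \<in> carrier G"
      by (auto simp: central_extension_def)
    \<comment> \<open>The first coordinate is the solution of \<open>y \<otimes> x = \<one>\<close>:
      it cancels \<open>q\<close> and the cocycle value at the pair of \<open>u\<close> and its
      inverse, and leaves the first coordinate of the unit.\<close>
    let ?y = "(inv\<^bsub>Q\<^esub> (c \<one>\<^bsub>G\<^esub> \<one>\<^bsub>G\<^esub> \<otimes>\<^bsub>Q\<^esub> q \<otimes>\<^bsub>Q\<^esub> c (inv\<^bsub>G\<^esub> u) u), inv\<^bsub>G\<^esub> u)"
    have "inv\<^bsub>Q\<^esub> (c \<one>\<^bsub>G\<^esub> \<one>\<^bsub>G\<^esub> \<otimes>\<^bsub>Q\<^esub> q \<otimes>\<^bsub>Q\<^esub> c (inv\<^bsub>G\<^esub> u) u) \<otimes>\<^bsub>Q\<^esub> q \<otimes>\<^bsub>Q\<^esub> c (inv\<^bsub>G\<^esub> u) u =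
        inv\<^bsub>Q\<^esub> (c \<one>\<^bsub>G\<^esub> \<one>\<^bsub>G\<^esub>)"
    proof -
      define a where "a = q \<otimes>\<^bsub>Q\<^esub> c (inv\<^bsub>G\<^esub> u) u"
      have a: "a \<in> carrier Q" using x c by (simp add: a_def)
      have "inv\<^bsub>Q\<^esub> (c \<one>\<^bsub>G\<^esub> \<one>\<^bsub>G\<^esub> \<otimes>\<^bsub>Q\<^esub> a) \<otimes>\<^bsub>Q\<^esub> a = inv\<^bsub>Q\<^esub> (c \<one>\<^bsub>G\<^esub> \<one>\<^bsub>G\<^esub>)"
        using a c by (simp add: Q.m_assoc Q.inv_mult)
      then show ?thesis
        using x c by (simp add: a_def Q.m_assoc)
    qed
    then show "\<exists>y\<in>carrier (central_extension Q G c).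
        y \<otimes>\<^bsub>central_extension Q G c\<^esub> x = \<one>\<^bsub>central_extension Q G c\<^esub>"
      using x c by (intro bexI[of _ ?y]) (auto simp: central_extension_def)
    show "\<one>\<^bsub>central_extension Q G c\<^esub> \<otimes>\<^bsub>central_extension Q G c\<^esub> x = x"
    proof -
      have "inv\<^bsub>Q\<^esub> (c \<one>\<^bsub>G\<^esub> \<one>\<^bsub>G\<^esub>) \<otimes>\<^bsub>Q\<^esub> q \<otimes>\<^bsub>Q\<^esub> c \<one>\<^bsub>G\<^esub> u =
          q \<otimes>\<^bsub>Q\<^esub> (inv\<^bsub>Q\<^esub> (c \<one>\<^bsub>G\<^esub> \<one>\<^bsub>G\<^esub>) \<otimes>\<^bsub>Q\<^esub> c \<one>\<^bsub>G\<^esub> \<one>\<^bsub>G\<^esub>)"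
        unfolding c_one[OF x(3)] using x c by (simp add: Q.m_ac)
      then show ?thesis
        using x c by (simp add: central_extension_def)
    qed
  qed (auto simp: central_extension_def c * G.m_assoc)
qed

text \<open>The identity lifts to a hom from the free group to the central extension given by \<open>c\<close>, and
  \<open>q\<close> is the first coordinate of the lift.\<close>

lemma free_group_cocycle_splits:
  assumes "comm_group Q"
    and c: "\<And>u v. u \<in> carrier (free_group S) \<Longrightarrow> v \<in> carrier (free_group S) \<Longrightarrow> c u v \<in> carrier Q"
    and cocycle: "\<And>u v w. u \<in> carrier (free_group S) \<Longrightarrow> v \<in> carrier (free_group S) \<Longrightarrow>
      w \<in> carrier (free_group S) \<Longrightarrow>
      c u v \<otimes>\<^bsub>Q\<^esub> c (u \<otimes>\<^bsub>free_group S\<^esub> v) w = c v w \<otimes>\<^bsub>Q\<^esub> c u (v \<otimes>\<^bsub>free_group S\<^esub> w)"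
  obtains q where "\<And>u. u \<in> carrier (free_group S) \<Longrightarrow> q u \<in> carrier Q"
    "\<And>u v. u \<in> carrier (free_group S) \<Longrightarrow> v \<in> carrier (free_group S) \<Longrightarrow>
      q (u \<otimes>\<^bsub>free_group S\<^esub> v) = q u \<otimes>\<^bsub>Q\<^esub> q v \<otimes>\<^bsub>Q\<^esub> c u v"
proof -
  let ?F = "free_group S"
  let ?E = "central_extension Q ?F c"
  interpret Q: comm_group Q by fact
  interpret F: group ?F by (rule group_free_group)
  interpret E: group ?E
    using assms by (intro group_central_extension group_free_group)
  obtain h where h: "h \<in> hom ?F ?E" "\<And>x. x \<in> S \<Longrightarrow> h (free_gen x) = (\<one>\<^bsub>Q\<^esub>, free_gen x)"
    using free_group_universal[OF E.is_group, of S "\<lambda>x. (\<one>\<^bsub>Q\<^esub>, free_gen x)"]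
    by (auto simp: central_extension_def free_gen_closed)
  \<comment> \<open>The lift of the generators is a section of the projection, because its composite
    with \<open>snd\<close> fixes every generator.\<close>
  have "snd \<in> hom ?E ?F"
    by (auto simp: hom_def central_extension_def)
  then have "snd \<circ> h \<in> hom ?F ?F"
    using h(1) by (rule hom_compose[rotated])
  moreover have "(\<lambda>u. u) \<in> hom ?F ?F"
    by (auto simp: hom_def)
  moreover have "free_gen ` S \<subseteq> carrier ?F" "\<And>x. x \<in> free_gen ` S \<Longrightarrow> (snd \<circ> h) x = x"
    using h(2) by (auto simp: free_gen_closed)
  ultimately have snd_h: "snd (h u) = u" if "u \<in> carrier ?F" for u
    using F.hom_eq_on_generate[of ?F "snd \<circ> h" "\<lambda>u. u" "free_gen ` S" u] that
    by (simp add: generate_free_gen group_free_group)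
  show thesis
  proof
    show "fst (h u) \<in> carrier Q" if "u \<in> carrier ?F" for u
      using hom_in_carrier[OF h(1) that] by (auto simp: central_extension_def)
    show "fst (h (u \<otimes>\<^bsub>?F\<^esub> v)) = fst (h u) \<otimes>\<^bsub>Q\<^esub> fst (h v) \<otimes>\<^bsub>Q\<^esub> c u v"
      if "u \<in> carrier ?F" "v \<in> carrier ?F" for u v
      using hom_mult[OF h(1) that] snd_h[OF that(1)] snd_h[OF that(2)]
      by (cases "h u"; cases "h v") (auto simp: central_extension_def)
  qed
qed

section \<open>Commutator subgroups\<close>

context group
begin

lemma commutator_closed:
  "g \<in> carrier G \<Longrightarrow> h \<in> carrier G \<Longrightarrow> commutator G g h \<in> carrier G"
  by (simp add: commutator_def)

text \<open>Apart from the commutator only products occur, so a function that is additive only when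
  one factor lies in a given normal subgroup can be applied to both sides.\<close>

lemma commutator_mult:
  "g \<in> carrier G \<Longrightarrow> h \<in> carrier G \<Longrightarrow> commutator G g h \<otimes> (h \<otimes> g) = g \<otimes> h"
  by (simp add: commutator_def m_assoc inv_solve_left' flip: inv_mult_group)

lemma commutator_in_commutator_subgroup:
  "h \<in> H \<Longrightarrow> k \<in> K \<Longrightarrow> commutator G h k \<in> commutator_subgroup G H K"
  unfolding commutator_subgroup_def by (rule generate.incl) blast

lemma commutator_subgroup_mono:
  "H \<subseteq> H' \<Longrightarrow> K \<subseteq> K' \<Longrightarrow> commutator_subgroup G H K \<subseteq> commutator_subgroup G H' K'"
  unfolding commutator_subgroup_def by (rule mono_generate) blast

lemma conj_commutator:
  assumes "g \<in> carrier G" "h \<in> carrier G" "k \<in> carrier G"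
  shows "g \<otimes> commutator G h k \<otimes> inv g = commutator G (g \<otimes> h \<otimes> inv g) (g \<otimes> k \<otimes> inv g)"
proof -
  have "inv g \<otimes> (g \<otimes> x) = x" if "x \<in> carrier G" for x
    using that assms by (simp flip: m_assoc)
  then show ?thesis
    using assms by (simp add: commutator_def m_assoc inv_mult_group)
qed

lemma commutator_subgroup_normal:
  assumes "N \<lhd> G"
  shows "commutator_subgroup G (carrier G) N \<lhd> G"
  unfolding commutator_subgroup_def
proof (rule normal_generateI)
  interpret N: normal N G by fact
  show "{commutator G h k |h k. h \<in> carrier G \<and> k \<in> N} \<subseteq> carrier G"
    by (auto intro: commutator_closed)
  fix x g
  assume "x \<in> {commutator G h k |h k. h \<in> carrier G \<and> k \<in> N}" and g: "g \<in> carrier G"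
  then obtain h k where "x = commutator G h k" "h \<in> carrier G" "k \<in> N" by blast
  then show "g \<otimes> x \<otimes> inv g \<in> {commutator G h k |h k. h \<in> carrier G \<and> k \<in> N}"
    using g conj_commutator[of g h k] N.inv_op_closed2[of g k] by auto
qed

lemma commutator_subgroup_subset:
  assumes "N \<lhd> G"
  shows "commutator_subgroup G (carrier G) N \<subseteq> N"
  unfolding commutator_subgroup_def
proof (rule generate_subgroup_incl)
  interpret N: normal N G by fact
  show "{commutator G h k |h k. h \<in> carrier G \<and> k \<in> N} \<subseteq> N"
    using N.inv_op_closed2 by (auto simp: commutator_def)
  show "subgroup N G" by (rule N.subgroup_axioms)
qed

lemma normal_closure_normal:
  assumes "S \<subseteq> carrier G"
  shows "normal_closure G S \<lhd> G"
  unfolding normal_closure_def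
proof (rule normal_generateI)
  show "{g \<otimes> s \<otimes> inv g |g s. g \<in> carrier G \<and> s \<in> S} \<subseteq> carrier G"
    using assms by auto
  fix x g assume "x \<in> {g \<otimes> s \<otimes> inv g |g s. g \<in> carrier G \<and> s \<in> S}" and g: "g \<in> carrier G"
  then obtain h s where x: "x = h \<otimes> s \<otimes> inv h" "h \<in> carrier G" "s \<in> S" by blast
  then have "g \<otimes> x \<otimes> inv g = (g \<otimes> h) \<otimes> s \<otimes> inv (g \<otimes> h)"
    using g assms by (simp add: m_assoc inv_mult_group subset_iff)
  then show "g \<otimes> x \<otimes> inv g \<in> {g \<otimes> s \<otimes> inv g |g s. g \<in> carrier G \<and> s \<in> S}"
    using x g by blast
qed

lemma normal_closure_subset:
  assumes "S \<subseteq> N" "N \<lhd> G"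
  shows "normal_closure G S \<subseteq> N"
  unfolding normal_closure_def
proof (rule generate_subgroup_incl)
  interpret N: normal N G by fact
  show "{g \<otimes> s \<otimes> inv g |g s. g \<in> carrier G \<and> s \<in> S} \<subseteq> N"
    using assms(1) N.inv_op_closed2 by auto
  show "subgroup N G" by (rule N.subgroup_axioms)
qed

lemma incl_normal_closure:
  assumes "S \<subseteq> carrier G"
  shows "S \<subseteq> normal_closure G S"
proof
  fix s assume "s \<in> S"
  moreover from this have "s = \<one> \<otimes> s \<otimes> inv \<one>" using assms by auto
  ultimately show "s \<in> normal_closure G S"
    unfolding normal_closure_def by (intro generate.incl) blast
qed

text \<open>No hom property on all of \<open>G\<close> is assumed. For \<open>k \<in> N\<close>,
  apply \<open>q\<close> to [h,k] kh = hk: additivity on the left holds as [h,k] is in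
  \<open>N\<close>, and q(hk) = q(kh) as \<open>Q\<close> is abelian, so q([h,k]) is
  trivial.\<close>

lemma trivial_on_commutator_subgroup:
  assumes "comm_group Q" "N \<lhd> G"
    and q: "\<And>u. u \<in> carrier G \<Longrightarrow> q u \<in> carrier Q"
    and q_mult: "\<And>u r. u \<in> carrier G \<Longrightarrow> r \<in> N \<Longrightarrow> q (u \<otimes> r) = q u \<otimes>\<^bsub>Q\<^esub> q r"
      "\<And>u r. u \<in> carrier G \<Longrightarrow> r \<in> N \<Longrightarrow> q (r \<otimes> u) = q r \<otimes>\<^bsub>Q\<^esub> q u"
    and x: "x \<in> commutator_subgroup G (carrier G) N"
  shows "q x = \<one>\<^bsub>Q\<^esub>"
proof -
  interpret Q: comm_group Q by fact
  interpret N: normal N G by fact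
  have "\<one> \<in> N" by simp
  then have q_one: "q \<one> = \<one>\<^bsub>Q\<^esub>"
    using q_mult(1)[of \<one> \<one>] q[of \<one>] by simp
  have comm: "q (commutator G h k) = \<one>\<^bsub>Q\<^esub>" if h: "h \<in> carrier G" and k: "k \<in> N" for h k
  proof -
    have "commutator G h k \<in> N"
      using h k N.inv_op_closed2 by (simp add: commutator_def)
    then have "q (commutator G h k) \<otimes>\<^bsub>Q\<^esub> q (k \<otimes> h) = q (h \<otimes> k)"
      using h k commutator_mult[of h k] q_mult(2)[of "k \<otimes> h" "commutator G h k"] by simp
    also have "q (h \<otimes> k) = q (k \<otimes> h)"
      using h k q by (simp add: q_mult Q.m_comm)
    finally show ?thesis
      using h k q[of "k \<otimes> h"] q[of "commutator G h k"]
      by (simp add: commutator_closed)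
  qed
  \<comment> \<open>Membership in \<open>N\<close> is carried through the induction because
    \<open>q\<close> is known to be additive only on products with a factor in
    \<open>N\<close>.\<close>
  have "x \<in> N \<and> q x = \<one>\<^bsub>Q\<^esub>"
    using x unfolding commutator_subgroup_def
  proof (induction rule: generate.induct)
    case one
    then show ?case using q_one by simp
  next
    case (incl h)
    then show ?case
      using comm N.inv_op_closed2 by (auto simp: commutator_def)
  next
    case (inv h)
    then obtain g k where h: "h = commutator G g k" "g \<in> carrier G" "k \<in> N" by blast
    then have "h \<in> N" "q h = \<one>\<^bsub>Q\<^esub>"
      using comm N.inv_op_closed2 by (auto simp: commutator_def)
    moreover have "q (inv h) \<otimes>\<^bsub>Q\<^esub> q h = q \<one>"
      using \<open>h \<in> N\<close> q_mult(1)[of "inv h" h] by simp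
    ultimately show ?case
      using q_one q[of "inv h"] by simp
  next
    case (eng g h)
    then show ?case using q_mult(1)[of g h] by simp
  qed
  then show ?thesis ..
qed

lemma hom_trivial_on_commutator_subgroup:
  assumes "comm_group Q" "f \<in> hom G Q" "x \<in> commutator_subgroup G (carrier G) (carrier G)"
  shows "f x = \<one>\<^bsub>Q\<^esub>"
  using assms trivial_on_commutator_subgroup[OF assms(1) normal_self, of f x]
  by (simp add: hom_mult hom_in_carrier)

lemma coset_commutes_mod_commutator_subgroup:
  assumes "N \<lhd> G" "u \<in> carrier G" "r \<in> N"
  shows "commutator_subgroup G (carrier G) N #> (u \<otimes> r) =
    commutator_subgroup G (carrier G) N #> (r \<otimes> u)"
proof -
  let ?C = "commutator_subgroup G (carrier G) N"
  interpret N: normal N G by fact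
  interpret C: normal ?C G by (rule commutator_subgroup_normal) fact
  have "?C #> (u \<otimes> r) = ?C #> (commutator G u r \<otimes> (r \<otimes> u))"
    using assms by (simp add: commutator_mult)
  also have "\<dots> = (?C #> commutator G u r) #> (r \<otimes> u)"
    using assms by (simp add: coset_mult_assoc C.subset commutator_closed)
  also have "?C #> commutator G u r = ?C"
    using assms by (intro coset_join2 C.subgroup_axioms commutator_closed
        commutator_in_commutator_subgroup) auto
  finally show ?thesis .
qed

text \<open>Modulo \<open>\<Gamma>\<close> the commutator [a,b] commutes with ba, so ab = [a,b] ba
  gives that the k-th power of ab is the k-th power of [a,b] times that of ba.\<close>

lemma relator_coset:
  fixes k :: nat
  assumes a: "a \<in> carrier G" and b: "b \<in> carrier G"
  defines "\<Gamma> \<equiv> commutator_subgroup G (carrier G) (commutator_subgroup G (carrier G) (carrier G))"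
  shows "\<Gamma> #> ((a \<otimes> b) [^] k \<otimes> inv ((b \<otimes> a) [^] k)) = \<Gamma> #> (commutator G a b [^] k)"
proof -
  let ?D = "commutator_subgroup G (carrier G) (carrier G)"
  have D: "?D \<lhd> G" by (rule commutator_subgroup_normal) (rule normal_self)
  interpret C: normal \<Gamma> G
    unfolding \<Gamma>_def by (rule commutator_subgroup_normal) fact
  interpret K: group "G Mod \<Gamma>" by (rule C.factorgroup_is_group)
  let ?e = "\<lambda>x. \<Gamma> #> x"
  have e: "?e x \<in> carrier (G Mod \<Gamma>)" if "x \<in> carrier G" for x
    using that by (auto simp: carrier_FactGroup)
  have e_mult: "?e (x \<otimes> y) = ?e x \<otimes>\<^bsub>G Mod \<Gamma>\<^esub> ?e y" if "x \<in> carrier G" "y \<in> carrier G" for x y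
    using that by (simp add: C.rcos_sum)
  have z: "commutator G a b \<in> carrier G" "commutator G a b \<in> ?D"
    using a b by (auto intro: commutator_closed commutator_in_commutator_subgroup)
  have comm: "?e (b \<otimes> a) \<otimes>\<^bsub>G Mod \<Gamma>\<^esub> ?e (commutator G a b) = ?e (commutator G a b) \<otimes>\<^bsub>G Mod \<Gamma>\<^esub> ?e (b \<otimes> a)"
    using coset_commutes_mod_commutator_subgroup[OF D, of "b \<otimes> a" "commutator G a b", folded \<Gamma>_def] a b z
    by (simp only: e_mult[symmetric] m_closed simp_thms)
  have "?e ((a \<otimes> b) [^] k) = (?e (commutator G a b) \<otimes>\<^bsub>G Mod \<Gamma>\<^esub> ?e (b \<otimes> a)) [^]\<^bsub>G Mod \<Gamma>\<^esub> k"
    using a b z by (simp only: C.FactGroup_pow[symmetric] m_closed commutator_mult e_mult[symmetric])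
  also have "\<dots> = ?e (commutator G a b) [^]\<^bsub>G Mod \<Gamma>\<^esub> k \<otimes>\<^bsub>G Mod \<Gamma>\<^esub> ?e (b \<otimes> a) [^]\<^bsub>G Mod \<Gamma>\<^esub> k"
    using a b z comm by (intro K.pow_mult_distrib e) auto
  also have "\<dots> = ?e (commutator G a b [^] k) \<otimes>\<^bsub>G Mod \<Gamma>\<^esub> ?e ((b \<otimes> a) [^] k)"
    using a b z by (simp only: C.FactGroup_pow m_closed)
  also have "\<dots> = ?e (commutator G a b [^] k \<otimes> (b \<otimes> a) [^] k)"
    using a b z by (simp only: e_mult nat_pow_closed m_closed)
  finally have "?e ((a \<otimes> b) [^] k) \<otimes>\<^bsub>G Mod \<Gamma>\<^esub> ?e (inv ((b \<otimes> a) [^] k)) =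
      ?e (commutator G a b [^] k \<otimes> (b \<otimes> a) [^] k) \<otimes>\<^bsub>G Mod \<Gamma>\<^esub> ?e (inv ((b \<otimes> a) [^] k))"
    by simp
  then show ?thesis
    using a b z by (simp only: e_mult[symmetric] nat_pow_closed m_closed inv_closed m_assoc r_inv r_one)
qed

end

section \<open>The abelian group N/[G,N] of a normal subgroup N\<close>

abbreviation (input) commutator_quotient :: "('a, 'b) monoid_scheme \<Rightarrow> 'a set \<Rightarrow> 'a set monoid" where
  "commutator_quotient G N \<equiv> G\<lparr>carrier := N\<rparr> Mod commutator_subgroup G (carrier G) N"

context normal
begin

abbreviation (input) commutators ("C") where
  "C \<equiv> commutator_subgroup G (carrier G) H"

lemma commutators_normal_in: "C \<lhd> G\<lparr>carrier := H\<rparr>"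
  by (intro normal_restrict_supergroup commutator_subgroup_normal commutator_subgroup_subset
      subgroup_axioms normal_axioms)

lemma carrier_commutator_quotient: "carrier (commutator_quotient G H) = (\<lambda>r. C #> r) ` H"
  by (simp add: carrier_FactGroup r_coset_def)

lemma coset_mult_commutator_quotient:
  assumes "r \<in> H" "s \<in> H"
  shows "(C #> r) \<otimes>\<^bsub>commutator_quotient G H\<^esub> (C #> s) = C #> (r \<otimes> s)"
proof -
  interpret C: normal C "G\<lparr>carrier := H\<rparr>" by (rule commutators_normal_in)
  show ?thesis using C.rcos_sum[of r s] assms by (simp add: r_coset_def)
qed

lemma commutator_quotient_comm_group: "comm_group (commutator_quotient G H)"
proof (rule group.group_comm_groupI)
  show "group (commutator_quotient G H)"
    by (rule normal.factorgroup_is_group) (rule commutators_normal_in)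
  fix x y
  assume "x \<in> carrier (commutator_quotient G H)" "y \<in> carrier (commutator_quotient G H)"
  then obtain r s where "x = C #> r" "y = C #> s" "r \<in> H" "s \<in> H"
    by (auto simp only: carrier_commutator_quotient)
  then show "x \<otimes>\<^bsub>commutator_quotient G H\<^esub> y = y \<otimes>\<^bsub>commutator_quotient G H\<^esub> x"
    using coset_commutes_mod_commutator_subgroup[OF normal_axioms]
    by (simp only: coset_mult_commutator_quotient mem_carrier)
qed

lemma coset_eq_one_commutator_quotient:
  assumes "r \<in> H"
  shows "C #> r = \<one>\<^bsub>commutator_quotient G H\<^esub> \<longleftrightarrow> r \<in> C"
proof -
  have "subgroup C G"
    using commutator_subgroup_normal[OF normal_axioms] by (rule normal_imp_subgroup)
  then show ?thesis
    using assms coset_join1[of C r] coset_join2[of r C] by auto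
qed

lemma coset_inv_commutator_quotient:
  assumes "r \<in> H"
  shows "C #> inv r = inv\<^bsub>commutator_quotient G H\<^esub> (C #> r)"
proof -
  interpret P: comm_group "commutator_quotient G H" by (rule commutator_quotient_comm_group)
  have "(C #> inv r) \<otimes>\<^bsub>commutator_quotient G H\<^esub> (C #> r) = C #> \<one>"
    using assms by (simp only: coset_mult_commutator_quotient m_inv_closed l_inv mem_carrier)
  also have "\<dots> = \<one>\<^bsub>commutator_quotient G H\<^esub>"
    unfolding coset_eq_one_commutator_quotient[OF subgroup.one_closed[OF subgroup_axioms]]
    unfolding commutator_subgroup_def by (rule generate.one)
  finally show ?thesis
    using assms by (intro P.inv_equality[symmetric])
      (auto simp only: carrier_commutator_quotient m_inv_closed)
qed

text \<open>Conjugation acts trivially on N/[G,N]. For this reason the relators alone, without their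
  conjugates, generate R/[F,R], and factor sets become cocycles with trivial action there.\<close>

lemma coset_conj_commutator_quotient:
  assumes "u \<in> carrier G" "r \<in> H"
  shows "C #> (u \<otimes> r \<otimes> inv u) = C #> r"
proof -
  have C: "C \<subseteq> carrier G"
    using commutator_subgroup_subset[OF normal_axioms] subset by blast
  have "C #> (u \<otimes> r \<otimes> inv u) = (C #> (u \<otimes> r)) #> inv u"
    using assms C by (simp add: coset_mult_assoc)
  also have "\<dots> = (C #> (r \<otimes> u)) #> inv u"
    using coset_commutes_mod_commutator_subgroup[OF normal_axioms] assms by simp
  also have "\<dots> = C #> r"
    using assms C by (simp add: coset_mult_assoc m_assoc)
  finally show ?thesis .
qed

text \<open>The hypotheses are those that a splitting satisfies: it is a hom on \<open>H\<close>
  though not on \<open>G\<close>, and additivity against elements of \<open>G\<close> is what makes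
  it kill [G,H].\<close>

lemma commutator_quotient_universal:
  assumes "comm_group Q"
    and q: "\<And>u. u \<in> carrier G \<Longrightarrow> q u \<in> carrier Q"
    and q_mult: "\<And>u r. u \<in> carrier G \<Longrightarrow> r \<in> H \<Longrightarrow> q (u \<otimes> r) = q u \<otimes>\<^bsub>Q\<^esub> q r"
      "\<And>u r. u \<in> carrier G \<Longrightarrow> r \<in> H \<Longrightarrow> q (r \<otimes> u) = q r \<otimes>\<^bsub>Q\<^esub> q u"
  obtains g where "g \<in> hom (commutator_quotient G H) Q" "\<And>r. r \<in> H \<Longrightarrow> g (C #> r) = q r"
proof -
  interpret Q: comm_group Q by fact
  interpret q: group_hom "G\<lparr>carrier := H\<rparr>" Q q
    using q q_mult subgroup_imp_group[OF subgroup_axioms]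
    by (auto simp: group_hom_def group_hom_axioms_def hom_def Q.is_group)
  have "C \<subseteq> kernel (G\<lparr>carrier := H\<rparr>) Q q"
    using trivial_on_commutator_subgroup[OF assms(1) normal_axioms, of q] q q_mult
      commutator_subgroup_subset[OF normal_axioms]
    by (auto simp: kernel_def)
  then obtain g where "g \<in> hom (commutator_quotient G H) Q"
    "\<And>r. r \<in> H \<Longrightarrow> g (r_coset (G\<lparr>carrier := H\<rparr>) C r) = q r"
    using q.FactGroup_universal_kernel[OF commutators_normal_in] by auto
  then show thesis
    using that by (simp add: r_coset_def)
qed

end

section \<open>The relators of an even Artin group\<close>

text \<open>With \<open>x s\<close> the exponent sum of \<open>s\<close>, the bilinear cocycle \<open>x i u * x j v\<close> splits; this is the
  Heisenberg representation that sends \<open>i\<close>, \<open>j\<close> to its generators and the rest to 1.\<close>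

lemma free_group_commutator_form:
  fixes S :: "'a set"
  defines "F \<equiv> free_group S"
  defines "D \<equiv> commutator_subgroup F (carrier F) (carrier F)"
  assumes "i \<in> S" "j \<in> S" "i \<noteq> j"
  obtains q :: "'a letter list \<Rightarrow> int" where
    "\<And>u r. u \<in> carrier F \<Longrightarrow> r \<in> D \<Longrightarrow> q (u \<otimes>\<^bsub>F\<^esub> r) = q u + q r"
    "\<And>u r. u \<in> carrier F \<Longrightarrow> r \<in> D \<Longrightarrow> q (r \<otimes>\<^bsub>F\<^esub> u) = q r + q u"
    "\<And>k l. k \<in> S \<Longrightarrow> l \<in> S \<Longrightarrow> q (commutator F (free_gen k) (free_gen l)) =
      (if k = i \<and> l = j then 1 else if k = j \<and> l = i then -1 else 0)"
proof -
  interpret F: group F unfolding F_def by (rule group_free_group)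
  define e where "e s k = (if k = s then 1 else 0 :: int)" for s k :: 'a
  have "\<exists>x \<in> hom F integer_group. \<forall>k\<in>S. x (free_gen k) = e s k" for s
    unfolding F_def by (rule free_group_universal[OF group_integer_group, of S "e s"]) auto
  then obtain x where x: "\<And>s. x s \<in> hom F integer_group"
    and x_gen: "\<And>s k. k \<in> S \<Longrightarrow> x s (free_gen k) = e s k" by metis
  have x_mult: "x s (u \<otimes>\<^bsub>F\<^esub> v) = x s u + x s v" if "u \<in> carrier F" "v \<in> carrier F" for s u v
    using hom_mult[OF x that] by simp
  have x_D: "x s r = 0" if "r \<in> D" for s r
    using F.hom_trivial_on_commutator_subgroup[OF abelian_integer_group x] that
    by (simp add: D_def)
  have D: "D \<subseteq> carrier F"
    unfolding D_def by (rule F.commutator_subgroup_subset) (rule F.normal_self)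
  obtain q :: "'a letter list \<Rightarrow> int" where
    q: "\<And>u v. u \<in> carrier F \<Longrightarrow> v \<in> carrier F \<Longrightarrow> q (u \<otimes>\<^bsub>F\<^esub> v) = q u + q v + x i u * x j v"
    using free_group_cocycle_splits[OF abelian_integer_group, of S "\<lambda>u v. x i u * x j v"]
    by (simp add: x_mult[unfolded F_def] F_def algebra_simps) blast
  show thesis
  proof
    show "q (u \<otimes>\<^bsub>F\<^esub> r) = q u + q r" "q (r \<otimes>\<^bsub>F\<^esub> u) = q r + q u"
      if "u \<in> carrier F" "r \<in> D" for u r
      using that D by (auto simp: q x_D)
    fix k l assume "k \<in> S" "l \<in> S"
    then have kl: "free_gen k \<in> carrier F" "free_gen l \<in> carrier F"
      by (simp_all add: F_def free_gen_closed)
    then have c: "commutator F (free_gen k) (free_gen l) \<in> D"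
      "commutator F (free_gen k) (free_gen l) \<in> carrier F"
      unfolding D_def by (auto intro: F.commutator_in_commutator_subgroup F.commutator_closed)
    have "q (commutator F (free_gen k) (free_gen l)) + q (free_gen l \<otimes>\<^bsub>F\<^esub> free_gen k) =
        q (free_gen k \<otimes>\<^bsub>F\<^esub> free_gen l)"
      using F.commutator_mult[OF kl] kl c q x_D
      by (metis F.m_closed add.right_neutral mult_zero_left)
    \<comment> \<open>The values of \<open>q\<close> at the two generators cancel in the difference
      of q(kl) and q(lk). What remains is the antisymmetrised cocycle, a 2 by 2 determinant.\<close>
    then have "q (commutator F (free_gen k) (free_gen l)) = e i k * e j l - e i l * e j k"
      using kl \<open>k \<in> S\<close> \<open>l \<in> S\<close> by (simp add: q x_gen)
    then show "q (commutator F (free_gen k) (free_gen l)) =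
        (if k = i \<and> l = j then 1 else if k = j \<and> l = i then -1 else 0)"
      using \<open>i \<noteq> j\<close> by (auto simp: e_def)
  qed
qed

text \<open>This is the factor cancelled when the coefficients of a combination of relators are read
  off.\<close>

lemma half_exponent_pos:
  assumes "coxeter_matrix n m" "(i, j) \<in> finite_pairs n m"
  shows "0 < the_enat (half_exponent m i j)"
proof -
  have ij: "i \<in> {1..n}" "j \<in> {1..n}" "i \<noteq> j" "half_exponent m i j < \<infinity>"
    using assms(2) by (auto simp: finite_pairs_def)
  then obtain k where k: "m i j = enat k"
    by (cases "m i j") (auto simp: half_exponent_def)
  have "2 \<le> m i j"
    using assms(1) ij by (auto simp: coxeter_matrix_def)
  then have "2 \<le> k"
    using k by (simp add: numeral_eq_enat)
  then show ?thesis
    using k by (simp add: half_exponent_def)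
qed

section \<open>Relators in the lower central series and the basis of R/[F,R]\<close>

locale artin =
  fixes n :: nat and m :: "nat \<Rightarrow> nat \<Rightarrow> enat" and F R D \<Gamma> FR
  assumes coxeter: "coxeter_matrix n m"
  defines "F \<equiv> artin_free n"
    and "R \<equiv> artin_relations n m"
    and "D \<equiv> commutator_subgroup F (carrier F) (carrier F)"
    and "\<Gamma> \<equiv> commutator_subgroup F (carrier F) D"
    and "FR \<equiv> commutator_subgroup F (carrier F) R"
begin

abbreviation rel where "rel \<equiv> artin_relator n m"
abbreviation P where "P \<equiv> commutator_quotient F R"

sublocale F: group F
  unfolding F_def by (rule group_free_group)

sublocale D: normal D F
  unfolding D_def by (rule F.commutator_subgroup_normal) (rule F.normal_self)

sublocale \<Gamma>: normal \<Gamma> F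
  unfolding \<Gamma>_def by (rule F.commutator_subgroup_normal) (rule D.normal_axioms)

lemma gen_closed:
  assumes "(i, j) \<in> finite_pairs n m"
  shows "free_gen i \<in> carrier F" "free_gen j \<in> carrier F"
  using assms by (auto simp: F_def finite_pairs_def intro!: free_gen_closed)

lemma relator_eq:
  "rel i j = (free_gen i \<otimes>\<^bsub>F\<^esub> free_gen j) [^]\<^bsub>F\<^esub> the_enat (half_exponent m i j) \<otimes>\<^bsub>F\<^esub>
    inv\<^bsub>F\<^esub> ((free_gen j \<otimes>\<^bsub>F\<^esub> free_gen i) [^]\<^bsub>F\<^esub> the_enat (half_exponent m i j))"
  by (simp only: artin_relator_def Let_def F_def)

lemma relator_closed:
  assumes "(i, j) \<in> finite_pairs n m"
  shows "rel i j \<in> carrier F"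
  using gen_closed[OF assms] by (simp add: relator_eq)

lemma relator_coset_lower_central:
  assumes "(i, j) \<in> finite_pairs n m"
  shows "\<Gamma> #>\<^bsub>F\<^esub> rel i j =
    \<Gamma> #>\<^bsub>F\<^esub> (commutator F (free_gen i) (free_gen j) [^]\<^bsub>F\<^esub> the_enat (half_exponent m i j))"
  using F.relator_coset[OF gen_closed[OF assms]]
  by (simp only: relator_eq \<Gamma>_def D_def)

lemma commutator_power_in_derived:
  assumes "(i, j) \<in> finite_pairs n m"
  shows "commutator F (free_gen i) (free_gen j) [^]\<^bsub>F\<^esub> (k::nat) \<in> D"
proof -
  have "commutator F (free_gen i) (free_gen j) \<in> D"
    unfolding D_def using gen_closed[OF assms] by (rule F.commutator_in_commutator_subgroup)
  then show ?thesis
    by (induction k) auto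
qed

lemma relator_decomp:
  assumes "(i, j) \<in> finite_pairs n m"
  obtains g where "g \<in> \<Gamma>"
    "rel i j = g \<otimes>\<^bsub>F\<^esub> commutator F (free_gen i) (free_gen j) [^]\<^bsub>F\<^esub> the_enat (half_exponent m i j)"
  using F.rcos_self[OF relator_closed[OF assms] \<Gamma>.subgroup_axioms] that
  unfolding relator_coset_lower_central[OF assms] by (auto simp: r_coset_def)

lemma lower_central_subset_derived: "\<Gamma> \<subseteq> D"
  unfolding \<Gamma>_def by (rule F.commutator_subgroup_subset) (rule D.normal_axioms)

lemma relator_in_derived:
  assumes "(i, j) \<in> finite_pairs n m"
  shows "rel i j \<in> D"
  using relator_decomp[OF assms] commutator_power_in_derived[OF assms]
    lower_central_subset_derived by (metis D.m_closed subsetD)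

sublocale R: normal R F
  unfolding R_def artin_relations_def F_def[symmetric]
  by (rule F.normal_closure_normal) (auto simp: relator_closed)

lemma relations_subset_derived: "R \<subseteq> D"
  unfolding R_def artin_relations_def F_def[symmetric]
  by (rule F.normal_closure_subset[OF _ D.normal_axioms]) (auto simp: relator_in_derived)

lemma relator_in_relations:
  assumes "(i, j) \<in> finite_pairs n m"
  shows "rel i j \<in> R"
proof -
  have "{rel i j | i j. (i, j) \<in> finite_pairs n m} \<subseteq> carrier F"
    by (auto simp: relator_closed)
  from F.incl_normal_closure[OF this] show ?thesis
    unfolding R_def artin_relations_def F_def[symmetric] using assms by blast
qed

text \<open>Up to the factor n(i,j) these are the coordinate functions dual to the relators. A
  relator is an element of \<open>\<Gamma>\<close>, which \<open>q\<close> kills, times a power of a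
  commutator, on which \<open>q\<close> is additive.\<close>

lemma relator_functional:
  assumes "(i, j) \<in> finite_pairs n m"
  obtains q :: "nat letter list \<Rightarrow> int" where
    "\<And>u r. u \<in> carrier F \<Longrightarrow> r \<in> D \<Longrightarrow> q (u \<otimes>\<^bsub>F\<^esub> r) = q u + q r"
    "\<And>u r. u \<in> carrier F \<Longrightarrow> r \<in> D \<Longrightarrow> q (r \<otimes>\<^bsub>F\<^esub> u) = q r + q u"
    "\<And>r. r \<in> \<Gamma> \<Longrightarrow> q r = 0"
    "\<And>k l. (k, l) \<in> finite_pairs n m \<Longrightarrow> q (rel k l) =
      (if k = i \<and> l = j then int (the_enat (half_exponent m i j)) else 0)"
proof -
  have "i \<in> {1..n}" "j \<in> {1..n}" "i \<noteq> j"
    using assms by (auto simp: finite_pairs_def)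
  then obtain q :: "nat letter list \<Rightarrow> int" where
    q: "\<And>u r. u \<in> carrier F \<Longrightarrow> r \<in> D \<Longrightarrow> q (u \<otimes>\<^bsub>F\<^esub> r) = q u + q r"
      "\<And>u r. u \<in> carrier F \<Longrightarrow> r \<in> D \<Longrightarrow> q (r \<otimes>\<^bsub>F\<^esub> u) = q r + q u"
    and q_gen: "\<And>k l. k \<in> {1..n} \<Longrightarrow> l \<in> {1..n} \<Longrightarrow> q (commutator F (free_gen k) (free_gen l)) =
      (if k = i \<and> l = j then 1 else if k = j \<and> l = i then -1 else 0)"
    using free_group_commutator_form[of i "{1..n}" j thesis, folded F_def, folded D_def] by blast
  have q_\<Gamma>: "q r = 0" if "r \<in> \<Gamma>" for r
    using F.trivial_on_commutator_subgroup[OF abelian_integer_group D.normal_axioms, of q r] that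
    by (simp add: q \<Gamma>_def)
  have q_one: "q \<one>\<^bsub>F\<^esub> = 0"
    using q_\<Gamma> by simp
  show thesis
  proof
    fix k l assume kl: "(k, l) \<in> finite_pairs n m"
    let ?c = "commutator F (free_gen k) (free_gen l)"
    have c: "?c \<in> D"
      using commutator_power_in_derived[OF kl, of 1] D.subset gen_closed[OF kl]
      by (simp add: F.commutator_closed)
    have q_pow: "q (?c [^]\<^bsub>F\<^esub> (t::nat)) = int t * q ?c" for t
      using c by (induction t) (auto simp: q q_one algebra_simps)
    obtain g where "g \<in> \<Gamma>" "rel k l = g \<otimes>\<^bsub>F\<^esub> ?c [^]\<^bsub>F\<^esub> the_enat (half_exponent m k l)"
      using relator_decomp[OF kl] by blast
    then have "q (rel k l) = int (the_enat (half_exponent m k l)) * q ?c"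
      using commutator_power_in_derived[OF kl] by (simp add: q q_\<Gamma> q_pow)
    \<comment> \<open>The value -1 would require \<open>k = j\<close> and \<open>l = i\<close>,
      which is impossible since both pairs are increasing.\<close>
    also have "q ?c = (if k = i \<and> l = j then 1 else 0)"
      using kl assms q_gen[of k l] by (auto simp: finite_pairs_def)
    finally show "q (rel k l) =
        (if k = i \<and> l = j then int (the_enat (half_exponent m i j)) else 0)"
      by auto
  qed (simp_all add: q q_\<Gamma>)
qed

text \<open>The last property is stronger than injectivity, which is its case
  \<open>r = \<one>\<close>. For general \<open>r\<close> in \<open>R \<inter> \<Gamma>\<close> it
  shows, together with surjectivity, that the class of \<open>r\<close> is trivial.\<close>

lemma relator_basis_hom:
  obtains h where
    "h \<in> hom (free_Abelian_group (finite_pairs n m)) P"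
    "\<And>i j. (i, j) \<in> finite_pairs n m \<Longrightarrow> h (frag_of (i, j)) = FR #>\<^bsub>F\<^esub> rel i j"
    "h ` carrier (free_Abelian_group (finite_pairs n m)) = carrier P"
    "\<And>c r. c \<in> carrier (free_Abelian_group (finite_pairs n m)) \<Longrightarrow> r \<in> R \<inter> \<Gamma> \<Longrightarrow>
      h c = FR #>\<^bsub>F\<^esub> r \<Longrightarrow> c = 0"
proof -
  let ?A = "free_Abelian_group (finite_pairs n m)"
  interpret P: comm_group P by (rule R.commutator_quotient_comm_group)
  have e: "FR #>\<^bsub>F\<^esub> r \<in> carrier P" if "r \<in> R" for r
    using that by (simp only: R.carrier_commutator_quotient FR_def imageI)
  have "(\<lambda>(i, j). FR #>\<^bsub>F\<^esub> rel i j) ` finite_pairs n m \<subseteq> carrier P"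
    using e relator_in_relations by (auto simp del: carrier_FactGroup)
  then obtain h where h: "h \<in> hom ?A P"
    and h_of: "\<And>i j. (i, j) \<in> finite_pairs n m \<Longrightarrow> h (frag_of (i, j)) = FR #>\<^bsub>F\<^esub> rel i j"
    using P.free_Abelian_group_universal[of "\<lambda>(i, j). FR #>\<^bsub>F\<^esub> rel i j" "finite_pairs n m"]
    by (metis case_prod_conv)
  interpret h: group_hom ?A P h
    using h by (simp add: group_hom_def group_hom_axioms_def P.is_group)
  have img: "subgroup (h ` carrier ?A) P" by (rule h.img_is_subgroup)
  let ?T = "{g \<otimes>\<^bsub>F\<^esub> s \<otimes>\<^bsub>F\<^esub> inv\<^bsub>F\<^esub> g |g s. g \<in> carrier F \<and> s \<in> {rel i j |i j. (i, j) \<in> finite_pairs n m}}"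
  have T: "t \<in> R \<and> FR #>\<^bsub>F\<^esub> t \<in> h ` carrier ?A" if "t \<in> ?T" for t
  proof -
    obtain g i j where t: "t = g \<otimes>\<^bsub>F\<^esub> rel i j \<otimes>\<^bsub>F\<^esub> inv\<^bsub>F\<^esub> g" "g \<in> carrier F"
      and ij: "(i, j) \<in> finite_pairs n m" using \<open>t \<in> ?T\<close> by blast
    have "FR #>\<^bsub>F\<^esub> t = h (frag_of (i, j))"
      using R.coset_conj_commutator_quotient[OF t(2) relator_in_relations[OF ij]] h_of[OF ij] t(1)
      by (simp add: FR_def)
    then show ?thesis
      using t ij relator_in_relations[OF ij] R.inv_op_closed2 by auto
  qed
  have surj: "r \<in> R \<and> FR #>\<^bsub>F\<^esub> r \<in> h ` carrier ?A" if "r \<in> generate F ?T" for r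
    using that
  proof (induction rule: generate.induct)
    case one
    have "FR #>\<^bsub>F\<^esub> \<one>\<^bsub>F\<^esub> = \<one>\<^bsub>P\<^esub>"
      unfolding FR_def R.coset_eq_one_commutator_quotient[OF subgroup.one_closed[OF R.subgroup_axioms]]
      unfolding commutator_subgroup_def by (rule generate.one)
    then show ?case
      using subgroup.one_closed[OF img] subgroup.one_closed[OF R.subgroup_axioms] by (simp only: simp_thms)
  next
    case (incl t)
    then show ?case by (rule T)
  next
    case (inv t)
    then show ?case
      using T[OF inv] R.coset_inv_commutator_quotient[of t]
        subgroup.m_inv_closed[OF img, of "FR #>\<^bsub>F\<^esub> t"]
      unfolding FR_def by (simp only: R.m_inv_closed simp_thms)
  next
    case (eng r s)
    then show ?case
      using R.coset_mult_commutator_quotient[of r s]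
        subgroup.m_closed[OF img, of "FR #>\<^bsub>F\<^esub> r" "FR #>\<^bsub>F\<^esub> s"]
      unfolding FR_def by (simp only: R.m_closed simp_thms)
  qed
  have "R = generate F ?T"
    unfolding R_def artin_relations_def normal_closure_def F_def[symmetric] ..
  then have "FR #>\<^bsub>F\<^esub> r \<in> h ` carrier ?A" if "r \<in> R" for r
    using surj[of r] that by blast
  then have "carrier P \<subseteq> h ` carrier ?A"
    unfolding R.carrier_commutator_quotient FR_def by blast
  then have onto: "h ` carrier ?A = carrier P"
    using subgroup.subset[OF img] by (rule subset_antisym[rotated])
  \<comment> \<open>The functional of the pair \<open>p\<close> factors through R/[F,R]. On
    \<open>h c\<close> it returns the coefficient of \<open>c\<close> at \<open>p\<close> times a
    positive number, and on the class of \<open>r\<close> it returns 0 because \<open>r\<close> lies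
    in \<open>\<Gamma>\<close>.\<close>
  have inj: "c = 0" if c: "c \<in> carrier ?A" and r: "r \<in> R \<inter> \<Gamma>" and hc: "h c = FR #>\<^bsub>F\<^esub> r" for c r
  proof (rule poly_mapping_eqI)
    fix p :: "nat \<times> nat"
    obtain i j where p: "p = (i, j)" by fastforce
    show "Poly_Mapping.lookup c p = Poly_Mapping.lookup 0 p"
    proof (cases "p \<in> finite_pairs n m")
      case False
      then show ?thesis using c by (auto simp: in_keys_iff)
    next
      case True
      let ?k = "int (the_enat (half_exponent m i j))"
      obtain q where q: "\<And>u r. u \<in> carrier F \<Longrightarrow> r \<in> D \<Longrightarrow> q (u \<otimes>\<^bsub>F\<^esub> r) = q u + q r"
          "\<And>u r. u \<in> carrier F \<Longrightarrow> r \<in> D \<Longrightarrow> q (r \<otimes>\<^bsub>F\<^esub> u) = q r + q u"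
        and q_\<Gamma>: "\<And>r. r \<in> \<Gamma> \<Longrightarrow> q r = 0"
        and q_rel: "\<And>k l. (k, l) \<in> finite_pairs n m \<Longrightarrow> q (rel k l) = (if k = i \<and> l = j then ?k else 0)"
        using relator_functional[OF True[unfolded p], of thesis] by blast
      obtain g where g: "g \<in> hom P integer_group" "\<And>r. r \<in> R \<Longrightarrow> g (FR #>\<^bsub>F\<^esub> r) = q r"
        using R.commutator_quotient_universal[OF abelian_integer_group, of q] relations_subset_derived
        by (auto simp: q subset_iff FR_def)
      have gh: "g \<circ> h \<in> hom ?A integer_group"
        using h g(1) by (rule hom_compose)
      interpret gh: group_hom ?A integer_group "g \<circ> h"
        using gh by (simp add: group_hom_def group_hom_axioms_def)
      have gh_diff: "g (h (x - y)) = g (h x) - g (h y)"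
        if "Poly_Mapping.keys x \<subseteq> finite_pairs n m" "Poly_Mapping.keys y \<subseteq> finite_pairs n m" for x y
        using that gh.hom_mult[of x "- y"] gh.hom_inv[of y] by simp
      have "g (h c) = ?k * Poly_Mapping.lookup c p"
        using c[unfolded carrier_free_Abelian_group_iff]
      proof (rule free_Abelian_group_induct)
        show "g (h 0) = ?k * Poly_Mapping.lookup 0 p"
          using gh.hom_one by simp
        show "g (h (x - y)) = ?k * Poly_Mapping.lookup (x - y) p"
          if "Poly_Mapping.keys x \<subseteq> finite_pairs n m" "Poly_Mapping.keys y \<subseteq> finite_pairs n m"
            "g (h x) = ?k * Poly_Mapping.lookup x p" "g (h y) = ?k * Poly_Mapping.lookup y p" for x y
          using that by (simp add: gh_diff lookup_minus algebra_simps)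
        show "g (h (frag_of a)) = ?k * Poly_Mapping.lookup (frag_of a) p"
          if "a \<in> finite_pairs n m" for a
          using that by (cases a) (auto simp: h_of g(2) relator_in_relations q_rel p)
      qed
      moreover have "g (h c) = 0"
        using r hc by (simp add: g(2) q_\<Gamma>)
      ultimately show ?thesis
        using half_exponent_pos[OF coxeter True[unfolded p]] by simp
    qed
  qed
  show thesis
    using that[OF h h_of onto inj] .
qed

text \<open>The class of an element of \<open>R \<inter> \<Gamma>\<close> is a combination of
  relators, and the functionals force all its coefficients to vanish. In other words, R/[F,R] embeds
  in F/[F,[F,F]].\<close>

lemma commutators_eq: "R \<inter> \<Gamma> = FR"
proof
  show "FR \<subseteq> R \<inter> \<Gamma>"
    unfolding FR_def \<Gamma>_def
    using F.commutator_subgroup_subset[OF R.normal_axioms]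
      F.commutator_subgroup_mono[OF subset_refl relations_subset_derived] by blast
  show "R \<inter> \<Gamma> \<subseteq> FR"
  proof
    fix r assume r: "r \<in> R \<inter> \<Gamma>"
    obtain h where h: "h \<in> hom (free_Abelian_group (finite_pairs n m)) P"
        "\<And>i j. (i, j) \<in> finite_pairs n m \<Longrightarrow> h (frag_of (i, j)) = FR #>\<^bsub>F\<^esub> rel i j"
        "h ` carrier (free_Abelian_group (finite_pairs n m)) = carrier P"
        "\<And>c r. c \<in> carrier (free_Abelian_group (finite_pairs n m)) \<Longrightarrow> r \<in> R \<inter> \<Gamma> \<Longrightarrow>
          h c = FR #>\<^bsub>F\<^esub> r \<Longrightarrow> c = 0"
      using relator_basis_hom[of thesis] by blast
    have "FR #>\<^bsub>F\<^esub> r \<in> h ` carrier (free_Abelian_group (finite_pairs n m))"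
      using r unfolding h(3) R.carrier_commutator_quotient FR_def by blast
    then obtain c where c: "c \<in> carrier (free_Abelian_group (finite_pairs n m))" "h c = FR #>\<^bsub>F\<^esub> r"
      by auto
    then have "FR #>\<^bsub>F\<^esub> r = h \<one>\<^bsub>free_Abelian_group (finite_pairs n m)\<^esub>"
      using h(4)[OF c(1) r c(2)] by simp
    also have "\<dots> = \<one>\<^bsub>P\<^esub>"
      using h(1) R.commutator_quotient_comm_group
      by (intro hom_one) (auto simp: comm_group_def)
    finally show "r \<in> FR"
      using r R.coset_eq_one_commutator_quotient[of r] by (simp add: FR_def)
  qed
qed

lemma relator_basis:
  "is_free_abelian_basis P (finite_pairs n m) (\<lambda>(i, j). FR #>\<^bsub>F\<^esub> rel i j)"
proof -
  let ?A = "free_Abelian_group (finite_pairs n m)"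
  interpret P: comm_group P by (rule R.commutator_quotient_comm_group)
  obtain h where h: "h \<in> hom ?A P"
      "\<And>i j. (i, j) \<in> finite_pairs n m \<Longrightarrow> h (frag_of (i, j)) = FR #>\<^bsub>F\<^esub> rel i j"
      "h ` carrier ?A = carrier P"
      "\<And>c r. c \<in> carrier ?A \<Longrightarrow> r \<in> R \<inter> \<Gamma> \<Longrightarrow> h c = FR #>\<^bsub>F\<^esub> r \<Longrightarrow> c = 0"
    using relator_basis_hom[of thesis] by blast
  have "FR #>\<^bsub>F\<^esub> \<one>\<^bsub>F\<^esub> = \<one>\<^bsub>P\<^esub>"
    using R.coset_eq_one_commutator_quotient[OF subgroup.one_closed[OF R.subgroup_axioms]] commutators_eq
    by (metis FR_def IntI subgroup.one_closed[OF R.subgroup_axioms] subgroup.one_closed[OF \<Gamma>.subgroup_axioms])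
  \<comment> \<open>The last property of \<open>h\<close> is used at the identity, which lies in
    \<open>R \<inter> \<Gamma>\<close>.\<close>
  then have "kernel ?A P h = {\<one>\<^bsub>?A\<^esub>}"
    using h(4)[of _ "\<one>\<^bsub>F\<^esub>"] hom_one[OF h(1)]
    by (auto simp: kernel_def P.is_group)
  then have "h \<in> iso ?A P"
    using h(1,3) by (simp add: iso_kernel_image P.is_group)
  then show ?thesis
    unfolding is_free_abelian_basis_def using h(2) P.comm_group_axioms by auto
qed

end

section \<open>Hopf's formula\<close>

text \<open>Differences are the form required by \<open>free_Abelian_group_induct\<close>, which
  builds elements from 0, generators and differences.\<close>

lemma hom_free_Abelian_group_diff:
  assumes "group H" "h \<in> hom (free_Abelian_group S) H"
    and "Poly_Mapping.keys x \<subseteq> S" "Poly_Mapping.keys y \<subseteq> S"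
  shows "h (x - y) = h x \<otimes>\<^bsub>H\<^esub> inv\<^bsub>H\<^esub> (h y)"
proof -
  interpret h: group_hom "free_Abelian_group S" H h
    using assms(1,2) by (simp add: group_hom_def group_hom_axioms_def)
  show ?thesis
    using assms(3,4) h.hom_mult[of x "- y"] h.hom_inv[of y] by simp
qed

lemma hom_free_Abelian_group_eqI:
  assumes "group H" "f \<in> hom (free_Abelian_group S) H" "g \<in> hom (free_Abelian_group S) H"
    and "\<And>x. x \<in> S \<Longrightarrow> f (frag_of x) = g (frag_of x)"
    and "Poly_Mapping.keys c \<subseteq> S"
  shows "f c = g c"
  using assms(5)
proof (rule free_Abelian_group_induct)
  show "f 0 = g 0"
    using hom_one[OF assms(2) _ assms(1)] hom_one[OF assms(3) _ assms(1)] by simp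
qed (simp_all add: assms(4) hom_free_Abelian_group_diff[OF assms(1,2)] hom_free_Abelian_group_diff[OF assms(1,3)])

section \<open>The bar complex in degrees 1 to 3\<close>

lemma bar_boundary_2:
  "bar_boundary 2 G (frag_of [g, h]) = frag_of [h] - frag_of [g \<otimes>\<^bsub>G\<^esub> h] + frag_of [g]"
  by (simp add: bar_boundary_def bar_face_def numeral_2_eq_2)

lemma bar_boundary_3:
  "bar_boundary 3 G (frag_of [g, h, k]) =
    frag_of [h, k] - frag_of [g \<otimes>\<^bsub>G\<^esub> h, k] + frag_of [g, h \<otimes>\<^bsub>G\<^esub> k] - frag_of [g, h]"
  by (simp add: bar_boundary_def bar_face_def numeral_3_eq_3)

lemma bar_boundary_diff:
  "bar_boundary p G (x - y) = bar_boundary p G x - bar_boundary p G y"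
  by (simp add: bar_boundary_def frag_extend_diff)

lemma bar_boundary_add:
  "bar_boundary p G (x + y) = bar_boundary p G x + bar_boundary p G y"
  by (simp add: bar_boundary_def frag_extend_add)

lemma bar_boundary_0: "bar_boundary p G 0 = 0"
  by (simp add: bar_boundary_def)

abbreviation bar_cells :: "nat \<Rightarrow> ('a, 'b) monoid_scheme \<Rightarrow> 'a list set" where
  "bar_cells p G \<equiv> {gs. length gs = p \<and> set gs \<subseteq> carrier G}"

lemma bar_cells_2: "bar_cells 2 G = {[g, h] |g h. g \<in> carrier G \<and> h \<in> carrier G}"
  by (auto simp: numeral_2_eq_2 length_Suc_conv)

lemma bar_cells_3:
  "bar_cells 3 G = {[g, h, k] |g h k. g \<in> carrier G \<and> h \<in> carrier G \<and> k \<in> carrier G}"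
  by (auto simp: numeral_3_eq_3 length_Suc_conv)

lemma keys_add_subset:
  fixes x y :: "'a \<Rightarrow>\<^sub>0 int"
  assumes "Poly_Mapping.keys x \<subseteq> S" "Poly_Mapping.keys y \<subseteq> S"
  shows "Poly_Mapping.keys (x + y) \<subseteq> S"
  using assms Poly_Mapping.keys_add[of x y] by blast

lemma keys_diff_subset:
  fixes x y :: "'a \<Rightarrow>\<^sub>0 int"
  assumes "Poly_Mapping.keys x \<subseteq> S" "Poly_Mapping.keys y \<subseteq> S"
  shows "Poly_Mapping.keys (x - y) \<subseteq> S"
  using assms keys_diff[of x y] by blast

context group
begin

lemma bar_boundary_2_hom: "bar_boundary 2 G \<in> hom (bar_chain_group 2 G) (bar_chain_group 1 G)"
proof -
  have "Poly_Mapping.keys (bar_boundary 2 G c) \<subseteq> bar_cells 1 G"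
    if "Poly_Mapping.keys c \<subseteq> bar_cells 2 G" for c
    using that
  proof (rule free_Abelian_group_induct)
    fix a assume "a \<in> bar_cells 2 G"
    then obtain g h where "a = [g, h]" "g \<in> carrier G" "h \<in> carrier G"
      unfolding bar_cells_2 by blast
    then show "Poly_Mapping.keys (bar_boundary 2 G (frag_of a)) \<subseteq> bar_cells 1 G"
      by (simp add: bar_boundary_2 keys_add_subset keys_diff_subset)
  qed (simp_all add: bar_boundary_diff bar_boundary_0 keys_diff_subset)
  then show ?thesis
    by (auto simp: hom_def bar_chain_group_def bar_boundary_add)
qed

lemma bar_boundary_3_hom: "bar_boundary 3 G \<in> hom (bar_chain_group 3 G) (bar_chain_group 2 G)"
proof -
  have "Poly_Mapping.keys (bar_boundary 3 G c) \<subseteq> bar_cells 2 G"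
    if "Poly_Mapping.keys c \<subseteq> bar_cells 3 G" for c
    using that
  proof (rule free_Abelian_group_induct)
    fix a assume "a \<in> bar_cells 3 G"
    then obtain g h k where "a = [g, h, k]" "g \<in> carrier G" "h \<in> carrier G" "k \<in> carrier G"
      unfolding bar_cells_3 by blast
    then show "Poly_Mapping.keys (bar_boundary 3 G (frag_of a)) \<subseteq> bar_cells 2 G"
      by (simp add: bar_boundary_3 keys_add_subset keys_diff_subset)
  qed (simp_all add: bar_boundary_diff bar_boundary_0 keys_diff_subset)
  then show ?thesis
    by (auto simp: hom_def bar_chain_group_def bar_boundary_add)
qed

lemma bar_boundary_2_3:
  assumes "c \<in> carrier (bar_chain_group 3 G)"
  shows "bar_boundary 2 G (bar_boundary 3 G c) = 0"
proof -
  have "Poly_Mapping.keys c \<subseteq> bar_cells 3 G"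
    using assms by (simp add: bar_chain_group_def)
  then show ?thesis
  proof (rule free_Abelian_group_induct)
    fix a assume "a \<in> bar_cells 3 G"
    then obtain g h k where "a = [g, h, k]" "g \<in> carrier G" "h \<in> carrier G" "k \<in> carrier G"
      unfolding bar_cells_3 by blast
    then show "bar_boundary 2 G (bar_boundary 3 G (frag_of a)) = 0"
      by (simp add: bar_boundary_3 bar_boundary_2 bar_boundary_diff bar_boundary_add m_assoc)
  qed (simp_all add: bar_boundary_diff bar_boundary_0)
qed

lemma bar_boundaries_2:
  "bar_boundaries 2 G = bar_boundary 3 G ` carrier (bar_chain_group 3 G)"
  by (simp add: bar_boundaries_def)

lemma comm_group_bar_chain_group: "comm_group (bar_chain_group p G)"
  by (simp add: bar_chain_group_def abelian_free_Abelian_group)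

lemma bar_boundaries_2_subgroup: "subgroup (bar_boundaries 2 G) (bar_chain_group 2 G)"
proof -
  interpret d: group_hom "bar_chain_group 3 G" "bar_chain_group 2 G" "bar_boundary 3 G"
    using comm_group_bar_chain_group bar_boundary_3_hom
    by (simp add: group_hom_def group_hom_axioms_def comm_group_def)
  show ?thesis
    unfolding bar_boundaries_2 by (rule d.img_is_subgroup)
qed

lemma bar_boundaries_2_subset_cycles: "bar_boundaries 2 G \<subseteq> bar_cycles 2 G"
  using bar_boundary_3_hom bar_boundary_2_3
  by (auto simp: bar_boundaries_2 bar_cycles_def hom_def)

lemma subgroup_bar_cycles_2: "subgroup (bar_cycles 2 G) (bar_chain_group 2 G)"
proof -
  interpret d: group_hom "bar_chain_group 2 G" "bar_chain_group 1 G" "bar_boundary 2 G"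
    using comm_group_bar_chain_group bar_boundary_2_hom
    by (simp add: group_hom_def group_hom_axioms_def comm_group_def)
  have "bar_cycles 2 G = kernel (bar_chain_group 2 G) (bar_chain_group 1 G) (bar_boundary 2 G)"
    by (auto simp: bar_cycles_def kernel_def bar_chain_group_def)
  then show ?thesis
    using d.subgroup_kernel by simp
qed

end

section \<open>Presentations F/R with R inside [F,F]\<close>

locale hopf_presentation = normal R F for R and F :: "'a letter list monoid" (structure) +
  fixes S :: "'a set"
  assumes free: "F = free_group S"
    and derived: "R \<subseteq> commutator_subgroup F (carrier F) (carrier F)"
begin

abbreviation "G \<equiv> F Mod R"
abbreviation "C2 \<equiv> bar_chain_group 2 G"
abbreviation "Z2 \<equiv> bar_cycles 2 G"
abbreviation "B2 \<equiv> bar_boundaries 2 G"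
text \<open>All 2-chains modulo boundaries, not just cycles: a single cell \<open>[g|h]\<close> need
  not be a cycle, yet its class is needed as the value of a cocycle.\<close>

abbreviation "Q \<equiv> C2 Mod B2"
abbreviation "P \<equiv> commutator_quotient F R"
abbreviation "\<pi> u \<equiv> R #> u"
abbreviation "e r \<equiv> commutator_subgroup F (carrier F) R #> r"
abbreviation "\<kappa> z \<equiv> B2 #>\<^bsub>C2\<^esub> z"

sublocale G: group G
  by (rule factorgroup_is_group)

sublocale C2: comm_group C2
  by (rule G.comm_group_bar_chain_group)

sublocale B2: normal B2 C2
  using G.bar_boundaries_2_subgroup C2.normal_iff_subgroup by blast

sublocale Q: comm_group Q
  by (rule C2.abelian_FactGroup) (rule G.bar_boundaries_2_subgroup)

sublocale P: comm_group P
  by (rule commutator_quotient_comm_group)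

lemma one_mem: "\<one> \<in> R"
  using subgroup.one_closed[OF subgroup_axioms] .

lemma pi_closed: "u \<in> carrier F \<Longrightarrow> \<pi> u \<in> carrier G"
  by (auto simp: carrier_FactGroup)

lemma pi_mult: "u \<in> carrier F \<Longrightarrow> v \<in> carrier F \<Longrightarrow> \<pi> u \<otimes>\<^bsub>G\<^esub> \<pi> v = \<pi> (u \<otimes> v)"
  by (simp add: rcos_sum)

lemma pi_rel: "r \<in> R \<Longrightarrow> \<pi> r = \<one>\<^bsub>G\<^esub>"
  using coset_join2[of r R] subgroup_axioms by simp

lemma pi_eqD: "u \<in> carrier F \<Longrightarrow> v \<in> carrier F \<Longrightarrow> \<pi> u = \<pi> v \<Longrightarrow> u \<otimes> inv v \<in> R"
  using repr_independenceD[OF subgroup_axioms] rcos_module_imp[OF is_group] by metis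

lemma e_closed: "r \<in> R \<Longrightarrow> e r \<in> carrier P"
  unfolding carrier_commutator_quotient by (rule imageI)

lemmas e_mult = coset_mult_commutator_quotient
lemmas e_inv = coset_inv_commutator_quotient
lemmas e_conj = coset_conj_commutator_quotient

lemma e_one: "e \<one> = \<one>\<^bsub>P\<^esub>"
  using e_closed[OF one_mem] e_mult[OF one_mem one_mem] by (simp del: one_FactGroup mult_FactGroup)

lemma C2_simps:
  "x \<in> carrier C2 \<longleftrightarrow> Poly_Mapping.keys x \<subseteq> bar_cells 2 G"
  "x \<otimes>\<^bsub>C2\<^esub> y = x + y" "\<one>\<^bsub>C2\<^esub> = 0"
  by (simp_all add: bar_chain_group_def)

lemma cell_closed:
  "g \<in> carrier G \<Longrightarrow> h \<in> carrier G \<Longrightarrow> frag_of [g, h] \<in> carrier C2"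
  by (simp add: C2_simps)

lemma C2_diff_closed: "x \<in> carrier C2 \<Longrightarrow> y \<in> carrier C2 \<Longrightarrow> x - y \<in> carrier C2"
  by (simp add: C2_simps keys_diff_subset)

lemma kappa_closed: "z \<in> carrier C2 \<Longrightarrow> \<kappa> z \<in> carrier Q"
  by (auto simp: carrier_FactGroup)

lemma kappa_add: "x \<in> carrier C2 \<Longrightarrow> y \<in> carrier C2 \<Longrightarrow> \<kappa> x \<otimes>\<^bsub>Q\<^esub> \<kappa> y = \<kappa> (x + y)"
  using B2.rcos_sum[of x y] by (simp add: C2_simps)

lemma kappa_eq_one: "z \<in> carrier C2 \<Longrightarrow> \<kappa> z = \<one>\<^bsub>Q\<^esub> \<longleftrightarrow> z \<in> B2"
  using C2.coset_join1[of B2 z] C2.coset_join2[of z B2] B2.subgroup_axioms by auto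

lemma kappa_diff:
  assumes "x \<in> carrier C2" "y \<in> carrier C2"
  shows "\<kappa> (x - y) = \<kappa> x \<otimes>\<^bsub>Q\<^esub> inv\<^bsub>Q\<^esub> \<kappa> y"
  using kappa_add[OF C2_diff_closed[OF assms] assms(2)] assms
  by (simp add: Q.inv_solve_right kappa_closed C2_diff_closed del: mult_FactGroup)

lemma kappa_eqI:
  assumes "x \<in> carrier C2" "y \<in> carrier C2" "x - y \<in> B2"
  shows "\<kappa> x = \<kappa> y"
proof -
  have "\<kappa> (x - y) \<otimes>\<^bsub>Q\<^esub> \<kappa> y = \<kappa> x"
    using kappa_add[OF C2_diff_closed[OF assms(1,2)] assms(2)] by simp
  moreover have "\<kappa> (x - y) = \<one>\<^bsub>Q\<^esub>"
    using assms kappa_eq_one C2_diff_closed by blast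
  ultimately show ?thesis
    using kappa_closed[OF assms(2)] Q.l_one by metis
qed

text \<open>Modulo boundaries this is the cocycle identity for the map sending (g,h) to the class of
  the cell \<open>[g|h]\<close>.\<close>

lemma boundary_mem:
  assumes "g \<in> carrier G" "h \<in> carrier G" "k \<in> carrier G"
  shows "frag_of [h, k] - frag_of [g \<otimes>\<^bsub>G\<^esub> h, k] + frag_of [g, h \<otimes>\<^bsub>G\<^esub> k] - frag_of [g, h] \<in> B2"
proof -
  have "frag_of [g, h, k] \<in> carrier (bar_chain_group 3 G)"
    using assms by (simp add: bar_chain_group_def)
  then show ?thesis
    unfolding G.bar_boundaries_2 bar_boundary_3[symmetric] by (rule imageI)
qed

section \<open>Factor sets and the map from 2-chains to R/[F,R]\<close>

text \<open>A set-theoretic section of F \<rightarrow> F/R. Its value at the identity is fixed so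
  that the factor set is trivial at the identity pair and the lift of the class of any r in
  \<open>R\<close> is \<open>\<one>\<close>.\<close>

definition lift where
  "lift g = (if g = \<one>\<^bsub>G\<^esub> then \<one> else SOME u. u \<in> carrier F \<and> \<pi> u = g)"

lemma lift_one: "lift \<one>\<^bsub>G\<^esub> = \<one>"
  by (simp add: lift_def)

lemma lift:
  assumes "g \<in> carrier G"
  shows "lift g \<in> carrier F" "\<pi> (lift g) = g"
proof -
  have "\<exists>u. u \<in> carrier F \<and> \<pi> u = g"
    using assms by (auto simp: carrier_FactGroup)
  from someI_ex[OF this] have "lift g \<in> carrier F \<and> \<pi> (lift g) = g"
    using pi_rel[OF one_mem] by (auto simp: lift_def)
  then show "lift g \<in> carrier F" "\<pi> (lift g) = g" by auto
qed

definition factor_set where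
  "factor_set g h = lift g \<otimes> lift h \<otimes> inv (lift (g \<otimes>\<^bsub>G\<^esub> h))"

lemma factor_set_mem:
  assumes "g \<in> carrier G" "h \<in> carrier G"
  shows "factor_set g h \<in> R"
proof -
  have "\<pi> (lift g \<otimes> lift h) = \<pi> (lift (g \<otimes>\<^bsub>G\<^esub> h))"
    using assms lift G.m_closed pi_mult by metis
  then show ?thesis
    unfolding factor_set_def using assms lift G.m_closed
    by (intro pi_eqD) (simp_all del: mult_FactGroup)
qed

lemma factor_set_mult:
  assumes "g \<in> carrier G" "h \<in> carrier G"
  shows "factor_set g h \<otimes> lift (g \<otimes>\<^bsub>G\<^esub> h) = lift g \<otimes> lift h"
  using assms lift(1) G.m_closed by (simp add: factor_set_def m_assoc del: mult_FactGroup)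

lemma factor_set_one: "factor_set \<one>\<^bsub>G\<^esub> \<one>\<^bsub>G\<^esub> = \<one>"
  using G.l_one[OF G.one_closed] unfolding factor_set_def by (simp only: lift_one) simp

text \<open>Associativity in \<open>F\<close> gives this identity with one term conjugated by
  \<open>lift g\<close>; the conjugation disappears modulo [F,R].\<close>

lemma factor_set_cocycle:
  assumes "g \<in> carrier G" "h \<in> carrier G" "k \<in> carrier G"
  shows "e (factor_set g h) \<otimes>\<^bsub>P\<^esub> e (factor_set (g \<otimes>\<^bsub>G\<^esub> h) k) =
    e (factor_set h k) \<otimes>\<^bsub>P\<^esub> e (factor_set g (h \<otimes>\<^bsub>G\<^esub> k))"
proof -
  let ?l = lift
  have gh: "g \<otimes>\<^bsub>G\<^esub> h \<in> carrier G" and hk: "h \<otimes>\<^bsub>G\<^esub> k \<in> carrier G"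
    and ghk: "g \<otimes>\<^bsub>G\<^esub> (h \<otimes>\<^bsub>G\<^esub> k) \<in> carrier G"
    using assms G.m_closed by blast+
  note l = lift(1)[OF assms(1)] lift(1)[OF assms(2)] lift(1)[OF assms(3)] lift(1)[OF gh] lift(1)[OF hk]
    lift(1)[OF ghk]
  have m: "factor_set g h \<in> R" "factor_set (g \<otimes>\<^bsub>G\<^esub> h) k \<in> R" "factor_set h k \<in> R" "factor_set g (h \<otimes>\<^bsub>G\<^esub> k) \<in> R"
    using factor_set_mem assms gh hk by blast+
  have c: "inv (?l x) \<otimes> (?l x \<otimes> y) = y" if "?l x \<in> carrier F" "y \<in> carrier F" for x y
    using that by (simp flip: m_assoc)
  have assoc: "(g \<otimes>\<^bsub>G\<^esub> h) \<otimes>\<^bsub>G\<^esub> k = g \<otimes>\<^bsub>G\<^esub> (h \<otimes>\<^bsub>G\<^esub> k)"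
    using assms by (rule G.m_assoc)
  have eq: "factor_set g h \<otimes> factor_set (g \<otimes>\<^bsub>G\<^esub> h) k =
      (?l g \<otimes> factor_set h k \<otimes> inv (?l g)) \<otimes> factor_set g (h \<otimes>\<^bsub>G\<^esub> k)"
    unfolding factor_set_def assoc using l by (simp add: m_assoc c del: mult_FactGroup)
  have "e (factor_set g h) \<otimes>\<^bsub>P\<^esub> e (factor_set (g \<otimes>\<^bsub>G\<^esub> h) k) =
      e (?l g \<otimes> factor_set h k \<otimes> inv (?l g)) \<otimes>\<^bsub>P\<^esub> e (factor_set g (h \<otimes>\<^bsub>G\<^esub> k))"
    using m l inv_op_closed2 eq by (simp only: e_mult)
  then show ?thesis
    using e_conj[OF l(1) m(3)] by (simp only:)
qed

text \<open>Linear extension of the factor set from cells to chains; its restriction to cycles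
  induces the isomorphism of Hopf's formula.\<close>

definition bar_hom where
  "bar_hom = (SOME \<phi>. \<phi> \<in> hom C2 P \<and>
    (\<forall>g\<in>carrier G. \<forall>h\<in>carrier G. \<phi> (frag_of [g, h]) = e (factor_set g h)))"

lemma bar_hom: "bar_hom \<in> hom C2 P"
  and bar_hom_of: "g \<in> carrier G \<Longrightarrow> h \<in> carrier G \<Longrightarrow> bar_hom (frag_of [g, h]) = e (factor_set g h)"
proof -
  let ?f = "\<lambda>gs. e (factor_set (gs ! 0) (gs ! 1))"
  have "?f ` bar_cells 2 G \<subseteq> carrier P"
    unfolding bar_cells_2 using e_closed factor_set_mem by auto
  then obtain \<phi> where "\<phi> \<in> hom (free_Abelian_group (bar_cells 2 G)) P"
      "\<And>x. x \<in> bar_cells 2 G \<Longrightarrow> \<phi> (frag_of x) = ?f x"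
    by (rule P.free_Abelian_group_universal) blast
  then have "\<exists>\<phi>. \<phi> \<in> hom C2 P \<and>
      (\<forall>g\<in>carrier G. \<forall>h\<in>carrier G. \<phi> (frag_of [g, h]) = e (factor_set g h))"
    by (intro exI[of _ \<phi>]) (simp add: bar_chain_group_def)
  from someI_ex[OF this] have *: "bar_hom \<in> hom C2 P \<and>
      (\<forall>g\<in>carrier G. \<forall>h\<in>carrier G. bar_hom (frag_of [g, h]) = e (factor_set g h))"
    unfolding bar_hom_def .
  show "bar_hom \<in> hom C2 P" using * ..
  show "g \<in> carrier G \<Longrightarrow> h \<in> carrier G \<Longrightarrow> bar_hom (frag_of [g, h]) = e (factor_set g h)"
    using * by blast
qed

sublocale \<phi>: group_hom C2 P bar_hom
  using bar_hom by (simp add: group_hom_def group_hom_axioms_def P.is_group)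

lemma bar_hom_add:
  "x \<in> carrier C2 \<Longrightarrow> y \<in> carrier C2 \<Longrightarrow> bar_hom (x + y) = bar_hom x \<otimes>\<^bsub>P\<^esub> bar_hom y"
  using hom_mult[OF bar_hom, of x y] by (simp add: C2_simps)

text \<open>The 3-cells generate the 3-chains, and on the boundary of a single 3-cell the claim is
  the cocycle identity of the factor set.\<close>

lemma bar_hom_boundary:
  assumes "z \<in> B2"
  shows "bar_hom z = \<one>\<^bsub>P\<^esub>"
proof -
  obtain c where c: "c \<in> carrier (bar_chain_group 3 G)" "z = bar_boundary 3 G c"
    using assms by (auto simp: G.bar_boundaries_2)
  have "bar_hom \<circ> bar_boundary 3 G \<in> hom (bar_chain_group 3 G) P"
    using G.bar_boundary_3_hom bar_hom by (rule Group.hom_compose)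
  moreover have "(\<lambda>_. \<one>\<^bsub>P\<^esub>) \<in> hom (bar_chain_group 3 G) P"
    using P.one_closed P.l_one[OF P.one_closed] by (simp only: hom_def mem_Collect_eq) auto
  moreover have "(bar_hom \<circ> bar_boundary 3 G) (frag_of gs) = \<one>\<^bsub>P\<^esub>" if gs: "gs \<in> bar_cells 3 G" for gs
  proof -
    obtain g h k where ghk: "gs = [g, h, k]" "g \<in> carrier G" "h \<in> carrier G" "k \<in> carrier G"
      using gs unfolding bar_cells_3 by blast
    then have m: "g \<otimes>\<^bsub>G\<^esub> h \<in> carrier G" "h \<otimes>\<^bsub>G\<^esub> k \<in> carrier G"
      using G.m_closed by blast+
    \<comment> \<open>Positive and negative part of the boundary: comparing their images keeps the
      argument free of inverses in \<open>P\<close>.\<close>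
    let ?a = "frag_of [h, k] + frag_of [g, h \<otimes>\<^bsub>G\<^esub> k]"
    let ?b = "frag_of [g, h] + frag_of [g \<otimes>\<^bsub>G\<^esub> h, k]"
    have ab: "?a \<in> carrier C2" "?b \<in> carrier C2"
      using C2.m_closed[OF cell_closed cell_closed] ghk m by (auto simp only: C2_simps(2))
    have bd: "bar_boundary 3 G (frag_of gs) + ?b = ?a"
      by (simp add: ghk(1) bar_boundary_3)
    then have "bar_boundary 3 G (frag_of gs) = ?a - ?b" by (simp add: eq_diff_eq)
    then have bc: "bar_boundary 3 G (frag_of gs) \<in> carrier C2"
      using C2_diff_closed[OF ab] by (simp only:)
    have "bar_hom ?a = bar_hom ?b"
      using ghk m by (simp only: bar_hom_add cell_closed bar_hom_of factor_set_cocycle)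
    moreover have "bar_hom (bar_boundary 3 G (frag_of gs)) \<otimes>\<^bsub>P\<^esub> bar_hom ?b = bar_hom ?a"
      using bar_hom_add[OF bc ab(2)] bd by (simp only:)
    ultimately show ?thesis
      using P.l_cancel_one'[of "bar_hom ?b" "bar_hom (bar_boundary 3 G (frag_of gs))"]
        P.r_cancel_one[of "bar_hom ?b" "bar_hom (bar_boundary 3 G (frag_of gs))"]
        \<phi>.hom_closed[OF ab(2)] \<phi>.hom_closed[OF bc] by (simp only: comp_apply simp_thms)
  qed
  ultimately have "(bar_hom \<circ> bar_boundary 3 G) c = \<one>\<^bsub>P\<^esub>"
    using c(1) unfolding bar_chain_group_def carrier_free_Abelian_group_iff
    by (rule hom_free_Abelian_group_eqI[OF P.is_group])
  then show ?thesis by (simp add: c(2))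
qed

text \<open>Subtracting \<open>[1|1]\<close> makes the cocycle trivial as soon as one argument lies in \<open>R\<close>.\<close>

definition pullback_cocycle where
  "pullback_cocycle u v = \<kappa> (frag_of [\<pi> u, \<pi> v] - frag_of [\<one>\<^bsub>G\<^esub>, \<one>\<^bsub>G\<^esub>])"

lemma pullback_cocycle_closed:
  "u \<in> carrier F \<Longrightarrow> v \<in> carrier F \<Longrightarrow> pullback_cocycle u v \<in> carrier Q"
  unfolding pullback_cocycle_def
  by (intro kappa_closed C2_diff_closed cell_closed pi_closed G.one_closed)

lemma pullback_cocycle_cocycle:
  assumes "u \<in> carrier F" "v \<in> carrier F" "w \<in> carrier F"
  shows "pullback_cocycle u v \<otimes>\<^bsub>Q\<^esub> pullback_cocycle (u \<otimes> v) w =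
    pullback_cocycle v w \<otimes>\<^bsub>Q\<^esub> pullback_cocycle u (v \<otimes> w)"
proof -
  let ?o = "frag_of [\<one>\<^bsub>G\<^esub>, \<one>\<^bsub>G\<^esub>]"
  note p = pi_closed[OF assms(1)] pi_closed[OF assms(2)] pi_closed[OF assms(3)]
  have uv: "u \<otimes> v \<in> carrier F" and vw: "v \<otimes> w \<in> carrier F"
    using assms by auto
  note cl = C2_diff_closed[OF cell_closed cell_closed[OF G.one_closed G.one_closed]]
  note c = cl[OF p(1,2)] cl[OF pi_closed[OF uv] p(3)] cl[OF p(2,3)] cl[OF p(1) pi_closed[OF vw]]
  \<comment> \<open>Both sides subtract \<open>?o\<close> twice, so the normalisation drops out and
    the boundary of the 3-cell on the images of u, v, w remains.\<close>
  have "(frag_of [\<pi> v, \<pi> w] - ?o) + (frag_of [\<pi> u, \<pi> (v \<otimes> w)] - ?o) -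
      ((frag_of [\<pi> u, \<pi> v] - ?o) + (frag_of [\<pi> (u \<otimes> v), \<pi> w] - ?o)) \<in> B2"
    using boundary_mem[OF p] pi_mult[OF assms(1,2)] pi_mult[OF assms(2,3)]
    by (simp add: algebra_simps)
  then show ?thesis
    unfolding pullback_cocycle_def kappa_add[OF c(1,2)] kappa_add[OF c(3,4)]
    using C2.m_closed[OF c(1,2)] C2.m_closed[OF c(3,4)]
    by (intro kappa_eqI[symmetric]) (simp_all only: C2_simps(2))
qed

text \<open>With g the image of u, the boundaries of \<open>[1|1|g]\<close> and
  \<open>[g|1|1]\<close> are \<open>[1|g] - [1|1]\<close> and \<open>[1|1] - [g|1]\<close>, so the
  three cells have the same class.\<close>

lemma pullback_cocycle_rel:
  assumes "u \<in> carrier F" "r \<in> R"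
  shows "pullback_cocycle u r = \<one>\<^bsub>Q\<^esub>" "pullback_cocycle r u = \<one>\<^bsub>Q\<^esub>"
proof -
  let ?o = "frag_of [\<one>\<^bsub>G\<^esub>, \<one>\<^bsub>G\<^esub>]"
  have u: "\<pi> u \<in> carrier G" using assms(1) by (rule pi_closed)
  have c: "frag_of [\<pi> u, \<one>\<^bsub>G\<^esub>] \<in> carrier C2" "frag_of [\<one>\<^bsub>G\<^esub>, \<pi> u] \<in> carrier C2" "?o \<in> carrier C2"
    using u by (intro cell_closed G.one_closed; simp)+
  have "frag_of [\<one>\<^bsub>G\<^esub>, \<pi> u] - ?o \<in> B2"
    using boundary_mem[OF G.one_closed G.one_closed u] unfolding G.l_one[OF u] G.l_one[OF G.one_closed]
    by simp
  moreover have "?o - frag_of [\<pi> u, \<one>\<^bsub>G\<^esub>] \<in> B2"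
    using boundary_mem[OF u G.one_closed G.one_closed] unfolding G.r_one[OF u] G.l_one[OF G.one_closed]
    by simp
  then have "\<kappa> (frag_of [\<pi> u, \<one>\<^bsub>G\<^esub>]) = \<kappa> ?o"
    by (rule kappa_eqI[OF c(3,1), symmetric])
  then have "\<kappa> (frag_of [\<pi> u, \<one>\<^bsub>G\<^esub>] - ?o) = \<one>\<^bsub>Q\<^esub>"
    using c by (simp only: kappa_diff Q.r_inv kappa_closed)
  ultimately show "pullback_cocycle u r = \<one>\<^bsub>Q\<^esub>" "pullback_cocycle r u = \<one>\<^bsub>Q\<^esub>"
    unfolding pullback_cocycle_def pi_rel[OF assms(2)]
    by (simp_all only: kappa_eq_one C2_diff_closed c)
qed

lemma pullback_splits:
  obtains q where "\<And>u. u \<in> carrier F \<Longrightarrow> q u \<in> carrier Q"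
    "\<And>u v. u \<in> carrier F \<Longrightarrow> v \<in> carrier F \<Longrightarrow>
      q (u \<otimes> v) = q u \<otimes>\<^bsub>Q\<^esub> q v \<otimes>\<^bsub>Q\<^esub> pullback_cocycle u v"
  using free_group_cocycle_splits[OF Q.comm_group_axioms, of S pullback_cocycle thesis, folded free]
    pullback_cocycle_closed pullback_cocycle_cocycle by blast

text \<open>These are the hypotheses of \<open>commutator_quotient_universal\<close>, so a splitting
  induces a hom from R/[F,R] to \<open>Q\<close>.\<close>

lemma split_rel:
  assumes q: "\<And>u. u \<in> carrier F \<Longrightarrow> q u \<in> carrier Q"
    and q_mult: "\<And>u v. u \<in> carrier F \<Longrightarrow> v \<in> carrier F \<Longrightarrow>
      q (u \<otimes> v) = q u \<otimes>\<^bsub>Q\<^esub> q v \<otimes>\<^bsub>Q\<^esub> pullback_cocycle u v"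
    and "u \<in> carrier F" "r \<in> R"
  shows "q (u \<otimes> r) = q u \<otimes>\<^bsub>Q\<^esub> q r" "q (r \<otimes> u) = q r \<otimes>\<^bsub>Q\<^esub> q u"
proof -
  have r: "r \<in> carrier F" using assms(4) by (rule mem_carrier)
  show "q (u \<otimes> r) = q u \<otimes>\<^bsub>Q\<^esub> q r"
    unfolding q_mult[OF assms(3) r] pullback_cocycle_rel[OF assms(3,4)]
    by (rule Q.r_one) (rule Q.m_closed[OF q[OF assms(3)] q[OF r]])
  show "q (r \<otimes> u) = q r \<otimes>\<^bsub>Q\<^esub> q u"
    unfolding q_mult[OF r assms(3)] pullback_cocycle_rel[OF assms(3,4)]
    by (rule Q.r_one) (rule Q.m_closed[OF q[OF r] q[OF assms(3)]])
qed

text \<open>The hom \<open>\<rho> \<circ> bar_hom\<close>, with \<open>\<rho>\<close> induced by \<open>q\<close>, differs from the quotient map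
  \<open>\<kappa>\<close> by a hom that factors through the boundary.\<close>

lemma bar_hom_injective:
  assumes z: "z \<in> Z2" and "bar_hom z = \<one>\<^bsub>P\<^esub>"
  shows "z \<in> B2"
proof -
  obtain q where q: "\<And>u. u \<in> carrier F \<Longrightarrow> q u \<in> carrier Q"
    and q_mult: "\<And>u v. u \<in> carrier F \<Longrightarrow> v \<in> carrier F \<Longrightarrow>
      q (u \<otimes> v) = q u \<otimes>\<^bsub>Q\<^esub> q v \<otimes>\<^bsub>Q\<^esub> pullback_cocycle u v"
    using pullback_splits[of thesis] by blast
  have q_rel: "q (u \<otimes> r) = q u \<otimes>\<^bsub>Q\<^esub> q r" "q (r \<otimes> u) = q r \<otimes>\<^bsub>Q\<^esub> q u"
    if "u \<in> carrier F" "r \<in> R" for u r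
    using split_rel[OF q q_mult that] by simp_all
  obtain \<rho> where \<rho>: "\<rho> \<in> hom P Q" and \<rho>_e: "\<And>r. r \<in> R \<Longrightarrow> \<rho> (e r) = q r"
    by (rule commutator_quotient_universal[OF Q.comm_group_axioms, of q])
      (assumption | rule q q_rel | rule that)+
  let ?o = "frag_of [\<one>\<^bsub>G\<^esub>, \<one>\<^bsub>G\<^esub>]"
  have o: "?o \<in> carrier C2" by (intro cell_closed G.one_closed)
  \<comment> \<open>The boundary of a 2-cell has coefficient sum 1, so the constant shift
    contributes exactly one \<open>- [1|1]\<close>, the term subtracted in
    \<open>pullback_cocycle\<close>.\<close>
  let ?t = "\<lambda>gs. q (lift (gs ! 0)) \<otimes>\<^bsub>Q\<^esub> inv\<^bsub>Q\<^esub> \<kappa> ?o"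
  have t_closed: "q (lift g) \<otimes>\<^bsub>Q\<^esub> inv\<^bsub>Q\<^esub> \<kappa> ?o \<in> carrier Q" if "g \<in> carrier G" for g
    using that o by (intro Q.m_closed Q.inv_closed q lift kappa_closed)
  have "?t ` bar_cells 1 G \<subseteq> carrier Q"
    using t_closed by (force simp: length_Suc_conv simp del: mult_FactGroup one_FactGroup)
  then obtain t where t: "t \<in> hom (bar_chain_group 1 G) Q"
      and t_of: "\<And>gs. gs \<in> bar_cells 1 G \<Longrightarrow> t (frag_of gs) = ?t gs"
    unfolding bar_chain_group_def[of 1] by (rule Q.free_Abelian_group_universal) blast
  have t_gen: "t (frag_of [g]) = q (lift g) \<otimes>\<^bsub>Q\<^esub> inv\<^bsub>Q\<^esub> \<kappa> ?o" if "g \<in> carrier G" for g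
    using that t_of[of "[g]"] by simp
  define \<tau> where "\<tau> = t \<circ> bar_boundary 2 G"
  have \<tau>: "\<tau> \<in> hom C2 Q"
    unfolding \<tau>_def using G.bar_boundary_2_hom t by (rule Group.hom_compose)
  have "(\<rho> \<circ> bar_hom) c = \<kappa> c \<otimes>\<^bsub>Q\<^esub> \<tau> c" if "Poly_Mapping.keys c \<subseteq> bar_cells 2 G" for c
    using that
  proof (rule hom_free_Abelian_group_eqI[OF Q.is_group, rotated -1])
    show "\<rho> \<circ> bar_hom \<in> hom (free_Abelian_group (bar_cells 2 G)) Q"
      using Group.hom_compose[OF bar_hom \<rho>] unfolding bar_chain_group_def[of 2] .
    have "(\<lambda>c. \<kappa> c \<otimes>\<^bsub>Q\<^esub> \<tau> c) \<in> hom C2 Q"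
    proof (rule homI)
      fix x y assume xy: "x \<in> carrier C2" "y \<in> carrier C2"
      note cl = kappa_closed[OF xy(1)] kappa_closed[OF xy(2)] hom_in_carrier[OF \<tau> xy(1)]
        hom_in_carrier[OF \<tau> xy(2)]
      show "\<kappa> x \<otimes>\<^bsub>Q\<^esub> \<tau> x \<in> carrier Q"
        using cl by (intro Q.m_closed)
      show "\<kappa> (x \<otimes>\<^bsub>C2\<^esub> y) \<otimes>\<^bsub>Q\<^esub> \<tau> (x \<otimes>\<^bsub>C2\<^esub> y) =
          (\<kappa> x \<otimes>\<^bsub>Q\<^esub> \<tau> x) \<otimes>\<^bsub>Q\<^esub> (\<kappa> y \<otimes>\<^bsub>Q\<^esub> \<tau> y)"
        unfolding hom_mult[OF \<tau> xy] unfolding C2_simps(2) kappa_add[OF xy, symmetric]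
        using cl by (simp only: Q.m_ac Q.m_closed)
    qed
    then show "(\<lambda>c. \<kappa> c \<otimes>\<^bsub>Q\<^esub> \<tau> c) \<in> hom (free_Abelian_group (bar_cells 2 G)) Q"
      unfolding bar_chain_group_def .
    fix gs assume "gs \<in> bar_cells 2 G"
    then obtain g h where gs: "gs = [g, h]" and g: "g \<in> carrier G" and h: "h \<in> carrier G"
      unfolding bar_cells_2 by blast
    have gh: "g \<otimes>\<^bsub>G\<^esub> h \<in> carrier G" using g h by (rule G.m_closed)
    define a where "a = q (lift g)"
    define b where "b = q (lift h)"
    define d where "d = q (lift (g \<otimes>\<^bsub>G\<^esub> h))"
    define w where "w = inv\<^bsub>Q\<^esub> \<kappa> ?o"
    define x where "x = \<kappa> (frag_of [g, h])"
    note cl = q[OF lift(1)[OF g], folded a_def] q[OF lift(1)[OF h], folded b_def]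
      q[OF lift(1)[OF gh], folded d_def] kappa_closed[OF cell_closed[OF g h], folded x_def]
      Q.inv_closed[OF kappa_closed[OF o], folded w_def]
    have "\<rho> (bar_hom (frag_of gs)) = q (factor_set g h)"
      using \<rho>_e[OF factor_set_mem[OF g h]] bar_hom_of[OF g h] by (simp only: gs)
    moreover have qf: "q (factor_set g h) \<in> carrier Q"
      using q mem_carrier factor_set_mem[OF g h] by blast
    \<comment> \<open>Here \<open>q\<close> is applied to both sides of
      \<open>factor_set_mult\<close>: it is additive on the left because the factor set lies in
      \<open>R\<close>, while the right side acquires the cocycle.\<close>
    moreover have "q (factor_set g h) \<otimes>\<^bsub>Q\<^esub> d = a \<otimes>\<^bsub>Q\<^esub> b \<otimes>\<^bsub>Q\<^esub> (x \<otimes>\<^bsub>Q\<^esub> w)"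
      using q_rel(2)[OF lift(1)[OF gh] factor_set_mem[OF g h]] q_mult[OF lift(1)[OF g] lift(1)[OF h]]
        kappa_diff[OF cell_closed[OF g h] o]
      unfolding factor_set_mult[OF g h] pullback_cocycle_def lift(2)[OF g] lift(2)[OF h]
      by (simp only: a_def b_def d_def x_def w_def)
    moreover have "\<tau> (frag_of gs) = (b \<otimes>\<^bsub>Q\<^esub> w) \<otimes>\<^bsub>Q\<^esub> inv\<^bsub>Q\<^esub> (d \<otimes>\<^bsub>Q\<^esub> w) \<otimes>\<^bsub>Q\<^esub> (a \<otimes>\<^bsub>Q\<^esub> w)"
    proof -
      have k: "Poly_Mapping.keys (frag_of [g]) \<subseteq> bar_cells 1 G" if "g \<in> carrier G" for g
        using that by simp
      have "t (frag_of [h] - frag_of [g \<otimes>\<^bsub>G\<^esub> h] + frag_of [g]) =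
          t (frag_of [h] - frag_of [g \<otimes>\<^bsub>G\<^esub> h]) \<otimes>\<^bsub>Q\<^esub> t (frag_of [g])"
        using hom_mult[OF t, of "frag_of [h] - frag_of [g \<otimes>\<^bsub>G\<^esub> h]" "frag_of [g]"]
          k[OF g] keys_diff_subset[OF k[OF h] k[OF gh]]
        unfolding bar_chain_group_def[of 1] carrier_free_Abelian_group_iff mult_free_Abelian_group by blast
      then show ?thesis
        unfolding \<tau>_def comp_apply gs bar_boundary_2
          hom_free_Abelian_group_diff[OF Q.is_group t[unfolded bar_chain_group_def[of 1]] k[OF h] k[OF gh]]
          t_gen[OF g] t_gen[OF h] t_gen[OF gh] a_def b_def d_def w_def .
    qed
    moreover have "(x \<otimes>\<^bsub>Q\<^esub> ((b \<otimes>\<^bsub>Q\<^esub> w) \<otimes>\<^bsub>Q\<^esub> inv\<^bsub>Q\<^esub> (d \<otimes>\<^bsub>Q\<^esub> w) \<otimes>\<^bsub>Q\<^esub> (a \<otimes>\<^bsub>Q\<^esub> w))) \<otimes>\<^bsub>Q\<^esub> d =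
        a \<otimes>\<^bsub>Q\<^esub> b \<otimes>\<^bsub>Q\<^esub> (x \<otimes>\<^bsub>Q\<^esub> w)"
    proof -
      have "(x \<otimes>\<^bsub>Q\<^esub> ((b \<otimes>\<^bsub>Q\<^esub> w) \<otimes>\<^bsub>Q\<^esub> inv\<^bsub>Q\<^esub> (d \<otimes>\<^bsub>Q\<^esub> w) \<otimes>\<^bsub>Q\<^esub> (a \<otimes>\<^bsub>Q\<^esub> w))) \<otimes>\<^bsub>Q\<^esub> d =
          (a \<otimes>\<^bsub>Q\<^esub> b \<otimes>\<^bsub>Q\<^esub> (x \<otimes>\<^bsub>Q\<^esub> w)) \<otimes>\<^bsub>Q\<^esub> ((d \<otimes>\<^bsub>Q\<^esub> w) \<otimes>\<^bsub>Q\<^esub> inv\<^bsub>Q\<^esub> (d \<otimes>\<^bsub>Q\<^esub> w))"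
        using cl Q.inv_closed[OF Q.m_closed[OF cl(3,5)]] by (simp only: Q.m_ac Q.m_closed)
      then show ?thesis
        using cl by (simp only: Q.r_inv Q.r_one Q.m_closed)
    qed
    ultimately show "(\<rho> \<circ> bar_hom) (frag_of gs) = \<kappa> (frag_of gs) \<otimes>\<^bsub>Q\<^esub> \<tau> (frag_of gs)"
      using cl Q.r_cancel[of "q (factor_set g h)" d "\<kappa> (frag_of gs) \<otimes>\<^bsub>Q\<^esub> \<tau> (frag_of gs)"]
      by (simp only: comp_apply gs x_def Q.m_closed Q.inv_closed simp_thms)
  qed
  then have "\<rho> (bar_hom z) = \<kappa> z \<otimes>\<^bsub>Q\<^esub> \<tau> z"
    using z by (simp add: bar_cycles_def C2_simps del: mult_FactGroup one_FactGroup)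
  moreover have "\<tau> z = \<one>\<^bsub>Q\<^esub>"
    using z hom_one[OF t _ Q.is_group] unfolding \<tau>_def bar_cycles_def bar_chain_group_def by simp
  moreover have "\<rho> (bar_hom z) = \<one>\<^bsub>Q\<^esub>"
    unfolding assms(2) by (rule hom_one[OF \<rho> P.is_group Q.is_group])
  moreover have "z \<in> carrier C2" using z by (simp add: bar_cycles_def)
  ultimately show ?thesis
    using kappa_eq_one kappa_closed Q.r_one by metis
qed

text \<open>Below \<open>\<mu>\<close> and \<open>\<chi>\<close> are homs from \<open>F\<close> to abelian groups, so they vanish at \<open>r \<in> [F,F]\<close>.  The
  first makes the chain \<open>z\<close> over \<open>q r\<close> a cycle, the second gives its image.\<close>

lemma bar_hom_surjective:
  assumes r: "r \<in> R"
  obtains z where "z \<in> Z2" "bar_hom z = e r"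
proof -
  obtain q where q: "\<And>u. u \<in> carrier F \<Longrightarrow> q u \<in> carrier Q"
    and q_mult: "\<And>u v. u \<in> carrier F \<Longrightarrow> v \<in> carrier F \<Longrightarrow>
      q (u \<otimes> v) = q u \<otimes>\<^bsub>Q\<^esub> q v \<otimes>\<^bsub>Q\<^esub> pullback_cocycle u v"
    using pullback_splits[of thesis] by blast
  have rF: "r \<in> carrier F" using r by (rule mem_carrier)
  obtain z where z: "z \<in> carrier C2" "q r = \<kappa> z"
    using q[OF rF] unfolding carrier_FactGroup[of C2 B2] by blast
  let ?C1 = "bar_chain_group 1 G"
  let ?o = "frag_of [\<one>\<^bsub>G\<^esub>, \<one>\<^bsub>G\<^esub>]"
  have o: "?o \<in> carrier C2" by (intro cell_closed G.one_closed)
  have C1: "comm_group ?C1" by (rule G.comm_group_bar_chain_group)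
  interpret d: group_hom C2 ?C1 "bar_boundary 2 G"
    using C1 G.bar_boundary_2_hom C2.is_group
    by (simp add: group_hom_def group_hom_axioms_def comm_group_def)
  have "B2 \<subseteq> kernel C2 ?C1 (bar_boundary 2 G)" "B2 \<subseteq> kernel C2 P bar_hom"
    using G.bar_boundaries_2_subset_cycles bar_hom_boundary B2.subset
    by (auto simp: kernel_def bar_cycles_def bar_chain_group_def simp del: one_FactGroup)
  note ker = this
  \<comment> \<open>Both the boundary and \<open>bar_hom\<close> are trivial on \<open>B2\<close>,
    so they are defined on \<open>Q\<close> and can be applied to the values of
    \<open>q\<close>.\<close>
  obtain \<delta> where \<delta>: "\<delta> \<in> hom Q ?C1" "\<And>x. x \<in> carrier C2 \<Longrightarrow> \<delta> (\<kappa> x) = bar_boundary 2 G x"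
    by (rule d.FactGroup_universal_kernel[OF B2.normal_axioms ker(1)]) (rule that)
  obtain \<psi> where \<psi>: "\<psi> \<in> hom Q P" "\<And>x. x \<in> carrier C2 \<Longrightarrow> \<psi> (\<kappa> x) = bar_hom x"
    by (rule \<phi>.FactGroup_universal_kernel[OF B2.normal_axioms ker(2)]) (rule that)
  have diff: "frag_of [\<pi> u, \<pi> v] - ?o \<in> carrier C2" if "u \<in> carrier F" "v \<in> carrier F" for u v
    using that by (rule C2_diff_closed[OF cell_closed[OF pi_closed pi_closed] o])
  have C1_simps: "x \<in> carrier ?C1 \<longleftrightarrow> Poly_Mapping.keys x \<subseteq> bar_cells 1 G"
    "x \<otimes>\<^bsub>?C1\<^esub> y = x + y" "\<one>\<^bsub>?C1\<^esub> = 0" for x y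
    by (simp_all add: bar_chain_group_def)
  \<comment> \<open>The boundary of the pullback cocycle is \<open>[v] - [uv] + [u] - [1]\<close>,
    taken in F/R, and the added term absorbs it. At \<open>r\<close> the added term is 0, so
    \<open>\<mu> r\<close> is the boundary of \<open>z\<close>.\<close>
  define \<mu> where "\<mu> u = \<delta> (q u) + frag_of [\<pi> u] - frag_of [\<one>\<^bsub>G\<^esub>]" for u
  have "\<mu> \<in> hom F ?C1"
  proof (rule homI)
    fix u v assume u: "u \<in> carrier F" and v: "v \<in> carrier F"
    have "Poly_Mapping.keys (\<delta> (q u)) \<subseteq> bar_cells 1 G"
      using hom_in_carrier[OF \<delta>(1) q[OF u]] unfolding C1_simps .
    then show "\<mu> u \<in> carrier ?C1"
      unfolding \<mu>_def C1_simps using pi_closed[OF u] G.one_closed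
      by (intro keys_diff_subset keys_add_subset) (simp_all del: one_FactGroup)
    have "\<delta> (q (u \<otimes> v)) = \<delta> (q u) + \<delta> (q v) + bar_boundary 2 G (frag_of [\<pi> u, \<pi> v] - ?o)"
      unfolding q_mult[OF u v] \<delta>(2)[OF diff[OF u v], symmetric] C1_simps(2)[symmetric]
        pullback_cocycle_def[symmetric]
      using q[OF u] q[OF v] pullback_cocycle_closed[OF u v]
      by (simp only: hom_mult[OF \<delta>(1)] Q.m_closed)
    then show "\<mu> (u \<otimes> v) = \<mu> u \<otimes>\<^bsub>?C1\<^esub> \<mu> v"
      unfolding \<mu>_def C1_simps bar_boundary_diff bar_boundary_2 pi_mult[OF u v]
        G.l_one[OF G.one_closed] by simp
  qed
  then have "\<mu> r = 0"
    using hom_trivial_on_commutator_subgroup[OF C1, of \<mu> r] r derived unfolding C1_simps by blast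
  then have cycle: "z \<in> Z2"
    unfolding \<mu>_def pi_rel[OF r] z(2) \<delta>(2)[OF z(1)] using z(1) by (simp add: bar_cycles_def)
  have y_mem: "lift (\<pi> u) \<otimes> inv u \<in> R" if "u \<in> carrier F" for u
    using that lift[OF pi_closed[OF that]] by (intro pi_eqD)
  \<comment> \<open>Under \<open>\<psi>\<close> the pullback cocycle becomes the class of the factor
    set, since \<open>bar_hom\<close> is trivial on \<open>[1|1]\<close>. The second factor, the
    deviation of \<open>u\<close> from the chosen lift of its class, absorbs it; at \<open>r\<close>
    this factor is \<open>e (inv r)\<close>.\<close>
  define \<chi> where "\<chi> u = \<psi> (q u) \<otimes>\<^bsub>P\<^esub> e (lift (\<pi> u) \<otimes> inv u)" for u
  have "\<chi> \<in> hom F P"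
  proof (rule homI)
    fix u v assume u: "u \<in> carrier F" and v: "v \<in> carrier F"
    show "\<chi> u \<in> carrier P"
      unfolding \<chi>_def using u by (intro P.m_closed hom_in_carrier[OF \<psi>(1)] q e_closed y_mem)
    have uv: "u \<otimes> v \<in> carrier F" using u v by simp
    note pu = pi_closed[OF u] and pv = pi_closed[OF v]
    let ?f = "factor_set (\<pi> u) (\<pi> v)"
    have f: "?f \<in> R" using pu pv by (rule factor_set_mem)
    have "bar_hom ?o = \<one>\<^bsub>P\<^esub>"
      unfolding bar_hom_of[OF G.one_closed G.one_closed] factor_set_one by (rule e_one)
    then have "\<psi> (pullback_cocycle u v) = e ?f"
      using bar_hom_add[OF diff[OF u v] o] \<phi>.hom_closed[OF diff[OF u v]] bar_hom_of[OF pu pv]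
      unfolding pullback_cocycle_def \<psi>(2)[OF diff[OF u v]]
      by (simp only: diff_add_cancel P.r_one)
    then have 1: "\<psi> (q (u \<otimes> v)) = \<psi> (q u) \<otimes>\<^bsub>P\<^esub> \<psi> (q v) \<otimes>\<^bsub>P\<^esub> e ?f"
      unfolding q_mult[OF u v]
      using q[OF u] q[OF v] pullback_cocycle_closed[OF u v]
      by (simp only: hom_mult[OF \<psi>(1)] Q.m_closed)
    let ?lu = "lift (\<pi> u)" and ?lv = "lift (\<pi> v)" and ?luv = "lift (\<pi> (u \<otimes> v))"
    note l = lift(1)[OF pu] lift(1)[OF pv] lift(1)[OF pi_closed[OF uv]]
    have c: "inv x \<otimes> (x \<otimes> y) = y" if "x \<in> carrier F" "y \<in> carrier F" for x y
      using that by (simp flip: m_assoc)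
    \<comment> \<open>Both sides equal the product of the lifts of the classes of \<open>u\<close>
      and \<open>v\<close> times the inverse of \<open>u \<otimes> v\<close>. The right side is
      arranged so that each factor lies in \<open>R\<close>, one of them up to a conjugation
      invisible in \<open>P\<close>.\<close>
    have "?f \<otimes> (?luv \<otimes> inv (u \<otimes> v)) = (?lu \<otimes> (?lv \<otimes> inv v) \<otimes> inv ?lu) \<otimes> (?lu \<otimes> inv u)"
      using l u v unfolding factor_set_def pi_mult[OF u v]
      by (simp add: m_assoc c inv_mult_group del: mult_FactGroup)
    then have 2: "e ?f \<otimes>\<^bsub>P\<^esub> e (?luv \<otimes> inv (u \<otimes> v)) = e (?lv \<otimes> inv v) \<otimes>\<^bsub>P\<^esub> e (?lu \<otimes> inv u)"
      using e_mult[OF f y_mem[OF uv]] e_conj[OF l(1) y_mem[OF v]]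
        e_mult[OF inv_op_closed2[OF l(1) y_mem[OF v]] y_mem[OF u]] by (simp only:)
    note cl = hom_in_carrier[OF \<psi>(1) q[OF u]] hom_in_carrier[OF \<psi>(1) q[OF v]]
      e_closed[OF f] e_closed[OF y_mem[OF u]] e_closed[OF y_mem[OF v]] e_closed[OF y_mem[OF uv]]
    have "\<chi> (u \<otimes> v) = \<psi> (q u) \<otimes>\<^bsub>P\<^esub> \<psi> (q v) \<otimes>\<^bsub>P\<^esub> (e ?f \<otimes>\<^bsub>P\<^esub> e (?luv \<otimes> inv (u \<otimes> v)))"
      unfolding \<chi>_def 1 using cl by (simp only: P.m_assoc P.m_closed)
    then show "\<chi> (u \<otimes> v) = \<chi> u \<otimes>\<^bsub>P\<^esub> \<chi> v"
      unfolding 2 unfolding \<chi>_def using cl by (simp only: P.m_ac P.m_closed)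
  qed
  then have "\<chi> r = \<one>\<^bsub>P\<^esub>"
    using hom_trivial_on_commutator_subgroup[OF P.comm_group_axioms, of \<chi> r] r derived by blast
  then have "bar_hom z \<otimes>\<^bsub>P\<^esub> e (inv r) = \<one>\<^bsub>P\<^esub>"
    unfolding \<chi>_def pi_rel[OF r] lift_one z(2) \<psi>(2)[OF z(1)] l_one[OF inv_closed[OF rF]] .
  then have "bar_hom z = e r"
    unfolding e_inv[OF r] using e_closed[OF r] \<phi>.hom_closed[OF z(1)]
    by (simp only: P.inv_solve_right[symmetric] P.inv_solve_right' P.l_one P.one_closed)
  with cycle show thesis by (rule that)
qed

text \<open>The first isomorphism theorem for \<open>bar_hom\<close> on cycles: on these its kernel
  is exactly the boundaries, and they already map onto \<open>P\<close>.\<close>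

theorem hopf_formula: "group_homology 2 G \<cong> P"
proof -
  let ?Z = "C2\<lparr>carrier := Z2\<rparr>"
  have Z: "Z2 \<subseteq> carrier C2" by (auto simp: bar_cycles_def)
  have "bar_hom \<in> hom ?Z P"
    using bar_hom Z by (auto simp: hom_def subset_iff)
  then interpret Z: group_hom ?Z P bar_hom
    using C2.subgroup_imp_group[OF G.subgroup_bar_cycles_2] P.is_group
    by (simp add: group_hom_def group_hom_axioms_def)
  have "kernel ?Z P bar_hom = B2"
    using bar_hom_injective bar_hom_boundary G.bar_boundaries_2_subset_cycles
    by (auto simp: kernel_def simp del: one_FactGroup)
  moreover have "bar_hom ` carrier ?Z = carrier P"
  proof
    show "bar_hom ` carrier ?Z \<subseteq> carrier P"
      using Z.hom_closed by blast
    show "carrier P \<subseteq> bar_hom ` carrier ?Z"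
    proof
      fix x assume "x \<in> carrier P"
      then obtain r where "r \<in> R" "x = e r"
        unfolding carrier_commutator_quotient by blast
      moreover from bar_hom_surjective[OF this(1)] obtain z where "z \<in> Z2" "bar_hom z = e r" .
      ultimately show "x \<in> bar_hom ` carrier ?Z" by (intro image_eqI[of _ _ z]) simp_all
    qed
  qed
  ultimately show ?thesis
    unfolding group_homology_def using Z.FactGroup_iso by simp
qed

end

text \<open>The last two conjuncts justify the notation of the basis: R/[F,R] embeds in F/[F,[F,F]],
  and there each relator has the same image as the power of the commutator that names its
  class.\<close>

theorem theorem4p2:
  fixes n :: nat and m :: "nat \<Rightarrow> nat \<Rightarrow> enat"
  assumes "n \<ge> 1" and "even_coxeter_matrix n m"
  defines "F \<equiv> artin_free n"
  defines "R \<equiv> artin_relations n m"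
  defines "FR \<equiv> commutator_subgroup F (carrier F) R"
  defines "\<Gamma> \<equiv> commutator_subgroup F (carrier F) (commutator_subgroup F (carrier F) (carrier F))"
  shows "group_homology 2 (artin_group n m) \<cong> F\<lparr>carrier := R\<rparr> Mod FR \<and>
    is_free_abelian_basis (F\<lparr>carrier := R\<rparr> Mod FR) (finite_pairs n m)
      (\<lambda>(i, j). FR #>\<^bsub>F\<^esub> artin_relator n m i j) \<and>
    R \<inter> \<Gamma> = FR \<and>
    (\<forall>(i, j) \<in> finite_pairs n m.
      \<Gamma> #>\<^bsub>F\<^esub> artin_relator n m i j =
      \<Gamma> #>\<^bsub>F\<^esub> (commutator F (free_gen i) (free_gen j) [^]\<^bsub>F\<^esub> the_enat (half_exponent m i j)))"
proof -
  interpret artin n m F R "commutator_subgroup F (carrier F) (carrier F)" \<Gamma> FR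
    using assms(2) by (simp_all only: artin_def even_coxeter_matrix_def F_def R_def FR_def \<Gamma>_def)
  interpret H: hopf_presentation R F "{1..n}"
    using R.normal_axioms relations_subset_derived
    by (auto simp: hopf_presentation_def hopf_presentation_axioms_def F_def)
  have "artin_group n m = F Mod R"
    by (simp only: artin_group_def F_def R_def)
  then have "group_homology 2 (artin_group n m) \<cong> F\<lparr>carrier := R\<rparr> Mod FR"
    using H.hopf_formula by (simp only: FR_def)
  moreover have "is_free_abelian_basis (F\<lparr>carrier := R\<rparr> Mod FR) (finite_pairs n m)
      (\<lambda>(i, j). FR #>\<^bsub>F\<^esub> artin_relator n m i j)"
    using relator_basis unfolding FR_def .
  ultimately show ?thesis
    using commutators_eq relator_coset_lower_central by blast
qed

end
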